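(* In the RESTART model with task time density $f$ and failure time distribution $G$, let $\alpha,\eta,\beta,\gamma>0$. As $x\to\infty$ (in the notation $\approx_{\log}$, $\approx_{\log\log}$ of the context): (1:1) If $f(t)\approx_{\log} e^{-\alpha t^\eta}$ and $\overline G(t)\approx_{\log} e^{-\beta t^\gamma}$, then $$\overline H(x)\approx_{\log}\exp\{-c_{11}(\log x)^{\theta_{11}}\},\qquad \theta_{11}=\eta/\gamma,\quad c_{11}=\alpha/\beta^{\theta_{11}} .$$ (2:2) If $f(t)\approx_{\log} t^{-(\alpha+1)}$ and $\overline G(t)\approx_{\log} t^{-\beta}$, then $$\overline H(x)\approx_{\log} x^{-\theta_{22}},\qquad \theta_{22}=\alpha/\beta .$$ (2:1) If $f(t)\approx_{\log} t^{-(\alpha+1)}$ and $\overline G(t)\approx_{\log} e^{-\beta t^\gamma}$, then $$\overline H(x)\approx_{\log} (\log x)^{-\theta_{21}},\qquad \theta_{21}=\alpha/\gamma .$$ (1:2) If $f(t)\approx_{\log} e^{-\alpha t^\eta}$ and $\overline G(t)\approx_{\log} t^{-\beta}$, then $$\overline H(x)\approx_{\log\log}\exp\{-x^{\theta_{12}}\},\qquad \theta_{12}=\eta/(\beta+\eta)\in(0,1) .$$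
   Context: RESTART model: $T$ is a nonnegative random variable (task time) with distribution $F$ having density $f$ on $[0,\infty)$. $U, U_1,U_2,\ldots$ are nonnegative i.i.d. random variables (failure times) with distribution $G$ having density $g$, independent of $T$. $N=\inf\{n\ge 0:\,U_{n+1}>T\}$, $S=\sum_{i=1}^N U_i$, and the total time is $X=T+S$ (with $X=\infty$ if $N=\infty$). Write $\overline G(t)=\mathbb P(U>t)$, $\overline H(x)=\mathbb P(X>x)$. Standing assumptions: $\mathbb E U<\infty$ (i.e. $\mu=1/\mathbb E U>0$) and the support of $F$ is unbounded. For two functions $p,q$, positive for all large arguments, with limit $0$ at $\infty$: $p(t)\approx_{\log} q(t)$ means $\log p(t)/\log q(t)\to1$ as $t\to\infty$; and $p(t)\approx_{\log\log}q(t)$ means $\log(-\log p(t))/\log(-\log q(t))\to 1$ as $t\to\infty$. *)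

theory Defs
  imports "HOL-Probability.Probability"
begin

definition tends_to_zero_positively :: "(real \<Rightarrow> real) \<Rightarrow> bool" where
  "tends_to_zero_positively p \<longleftrightarrow> eventually (\<lambda>t. p t > 0) at_top \<and> (p \<longlongrightarrow> 0) at_top"

text \<open>Both relations are only meaningful for functions that are eventually positive and tend to
  zero, so this is part of their definition.\<close>

definition log_equiv :: "(real \<Rightarrow> real) \<Rightarrow> (real \<Rightarrow> real) \<Rightarrow> bool"
    (infix \<open>\<approx>\<^sub>l\<^sub>o\<^sub>g\<close> 50) where
  "p \<approx>\<^sub>l\<^sub>o\<^sub>g q \<longleftrightarrow>
     tends_to_zero_positively p \<and> tends_to_zero_positively q \<and>
     ((\<lambda>t. ln (p t) / ln (q t)) \<longlongrightarrow> 1) at_top"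

definition loglog_equiv :: "(real \<Rightarrow> real) \<Rightarrow> (real \<Rightarrow> real) \<Rightarrow> bool"
    (infix \<open>\<approx>\<^sub>l\<^sub>o\<^sub>g\<^sub>l\<^sub>o\<^sub>g\<close> 50) where
  "p \<approx>\<^sub>l\<^sub>o\<^sub>g\<^sub>l\<^sub>o\<^sub>g q \<longleftrightarrow>
     tends_to_zero_positively p \<and> tends_to_zero_positively q \<and>
     ((\<lambda>t. ln (- ln (p t)) / ln (- ln (q t))) \<longlongrightarrow> 1) at_top"

definition measure_support :: "'b :: topological_space measure \<Rightarrow> 'b set" where
  "measure_support \<nu> = {x. \<forall>V. open V \<longrightarrow> x \<in> V \<longrightarrow> emeasure \<nu> V > 0}"

text \<open>The value \<open>U 0\<close> is the generic failure time \<open>U\<close>; the actual failure times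
  \<open>U\<^sub>1, U\<^sub>2, \<dots>\<close> are \<open>U 1, U 2, \<dots>\<close>. The densities \<open>f\<close> and \<open>g\<close> live on
  \<open>{0..}\<close>; their values at negative arguments are irrelevant.
  Under the assumption \<open>indep\<close>, the family \<open>T, U 0, U 1, \<dots>\<close> (indexed by \<^typ>\<open>nat option\<close>, with
  \<open>T\<close> at \<open>None\<close>) is mutually independent, i.e. the \<open>U i\<close> are independent and the whole sequence is
  independent of \<open>T\<close>.\<close>

locale restart_model = prob_space M
  for M :: "'a measure" +
  fixes T :: "'a \<Rightarrow> real" and U :: "nat \<Rightarrow> 'a \<Rightarrow> real" and f g :: "real \<Rightarrow> real"
  assumes T_nonneg: "\<And>\<omega>. \<omega> \<in> space M \<Longrightarrow> 0 \<le> T \<omega>"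
    and U_nonneg: "\<And>i \<omega>. \<omega> \<in> space M \<Longrightarrow> 0 \<le> U i \<omega>"
    and f_nonneg: "\<And>t. 0 \<le> t \<Longrightarrow> 0 \<le> f t"
    and g_nonneg: "\<And>t. 0 \<le> t \<Longrightarrow> 0 \<le> g t"
    and T_density: "distributed M lborel T (\<lambda>t. ennreal (f t * indicator {0..} t))"
    and U_density: "\<And>i. distributed M lborel (U i) (\<lambda>t. ennreal (g t * indicator {0..} t))"
    and indep: "indep_vars (\<lambda>_. borel) (case_option T U) UNIV"
    and U_integrable: "integrable M (U 0)"
    and T_support_unbounded: "\<not> bounded (measure_support (distr M borel T))"

text \<open>\<open>Inf {} = \<infinity>\<close> in \<^typ>\<open>enat\<close>, so the number of failures is infinite if no attempt ever
  succeeds.\<close>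

definition num_failures :: "('a \<Rightarrow> real) \<Rightarrow> (nat \<Rightarrow> 'a \<Rightarrow> real) \<Rightarrow> 'a \<Rightarrow> enat" where
  "num_failures T U \<omega> = Inf {enat n | n. U (n + 1) \<omega> > T \<omega>}"

definition total_time :: "('a \<Rightarrow> real) \<Rightarrow> (nat \<Rightarrow> 'a \<Rightarrow> real) \<Rightarrow> 'a \<Rightarrow> ereal" where
  "total_time T U \<omega> =
     (case num_failures T U \<omega> of
        enat n \<Rightarrow> ereal (T \<omega> + (\<Sum>i=1..n. U i \<omega>))
      | \<infinity> \<Rightarrow> \<infinity>)"

definition failure_tail :: "'a measure \<Rightarrow> (nat \<Rightarrow> 'a \<Rightarrow> real) \<Rightarrow> real \<Rightarrow> real" where
  "failure_tail M U t = measure M {\<omega> \<in> space M. U 0 \<omega> > t}"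

definition total_time_tail ::
    "'a measure \<Rightarrow> ('a \<Rightarrow> real) \<Rightarrow> (nat \<Rightarrow> 'a \<Rightarrow> real) \<Rightarrow> real \<Rightarrow> real" where
  "total_time_tail M T U x = measure M {\<omega> \<in> space M. total_time T U \<omega> > ereal x}"

end

theory Submission
  imports Defs
begin

text \<open>
  Write \<open>A s = P(T > s)\<close>, \<open>B s = P(U > s)\<close> and \<open>H x = P(X > x)\<close>. A task of length \<open>s\<close> needs about
  \<open>1 / B s\<close> attempts, each costing time of order one, so \<open>X > x\<close> happens typically either because the
  task is long or because a task of moderate length meets unusually many failures. This is made precise
  by two inequalities in which the level \<open>s\<close> may be chosen freely for each \<open>x\<close>:
  \<open>A s * exp (- K * x * B s) / 2 \<le> H x\<close> for \<open>x \<ge> 1\<close> and large \<open>s\<close>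
  (\<open>total_time_tail_lower_bound\<close>), and \<open>H x \<le> A s + 2 * exp (- c * x * B s)\<close> for
  \<open>0 < s \<le> x / 2\<close> (\<open>total_time_tail_upper_bound\<close>).

  Neither bound conditions on \<open>T\<close>. For the lower one, intersect \<open>T > s\<close> with the event that the first
  \<open>n\<close> failure times are at most \<open>s\<close> and add up to more than \<open>x\<close>, where \<open>n\<close> is a large multiple of \<open>x\<close>;
  the exceptional event that the sum stays below \<open>x\<close> is exponentially small by a Chernoff bound.
  For the upper one, if \<open>T \<le> s\<close> then \<open>X\<close> is at most \<open>s\<close> plus the failure times that precede the first one
  exceeding \<open>s\<close>, a geometric sum of truncated variables independent of \<open>T\<close>; Markov's inequality
  \<open>s * B s \<le> E U\<close> makes an exponential moment with parameter of order \<open>B s\<close> available.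

  On the logarithmic scale these bounds pinch \<open>H\<close> once \<open>s\<close> is chosen well. If \<open>- ln (A s)\<close> grows
  more slowly than every power of \<open>x\<close> at the critical level, that level is \<open>B s = 1 / x\<close>: taking
  \<open>B s\<close> near \<open>x powr (- r)\<close> with \<open>r\<close> slightly above or below \<open>1\<close> makes the factor \<open>exp (- K * x * B s)\<close>
  harmless, respectively the term \<open>exp (- c * x * B s)\<close> negligible, and \<open>H x\<close> behaves like \<open>A s\<close>
  (\<open>log_asymptotics\<close>). With a Weibull-type task time and power-law failures the two exponents
  \<open>- ln (A s)\<close> and \<open>x * B s\<close> have to be balanced instead: \<open>s powr \<eta> = x * s powr (- \<beta>)\<close> gives
  \<open>s = x powr (1 / (\<beta> + \<eta>))\<close> and the common exponent \<open>x powr (\<eta> / (\<beta> + \<eta>))\<close>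
  (\<open>loglog_asymptotics\<close>). The finite mean of \<open>U\<close> forces \<open>\<beta> \<ge> 1\<close>, which is what keeps the chosen \<open>s\<close>
  below \<open>x / 2\<close> for power-law failures.
\<close>

section \<open>Independence and elementary tail facts\<close>

definition task_tail :: "'a measure \<Rightarrow> ('a \<Rightarrow> real) \<Rightarrow> real \<Rightarrow> real" where
  "task_tail M T t = measure M {\<omega> \<in> space M. T \<omega> > t}"

context restart_model
begin

lemma T_measurable [measurable]: "T \<in> borel_measurable M"
  using distributed_measurable[OF T_density] by simp

lemma U_measurable [measurable]: "U i \<in> borel_measurable M"
  using distributed_measurable[OF U_density] by simp

lemma U_identically_distributed: "distr M borel (U i) = distr M borel (U 0)"
proof -
  have "distr M borel (U i) = distr M lborel (U i)" for i
    by (rule distr_cong) auto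
  then show ?thesis
    using distributed_distr_eq_density[OF U_density] by simp
qed

lemma expectation_U_eq:
  fixes h :: "real \<Rightarrow> real"
  assumes "h \<in> borel_measurable borel"
  shows "expectation (\<lambda>\<omega>. h (U i \<omega>)) = expectation (\<lambda>\<omega>. h (U 0 \<omega>))"
  using integral_distr[OF U_measurable assms, of i] integral_distr[OF U_measurable assms, of 0]
  by (simp add: U_identically_distributed[of i])

text \<open>The only consequence of independence that the estimates use. The functions \<open>h i\<close> need to be
  bounded on the nonnegative half-line only, which admits exponentials of \<open>- U\<close> as well as truncated exponentials
  of \<open>U\<close>.\<close>

lemma
  fixes k :: "real \<Rightarrow> real" and h :: "nat \<Rightarrow> real \<Rightarrow> real"
  assumes "finite I"
    and [measurable]: "k \<in> borel_measurable borel" "\<And>i. h i \<in> borel_measurable borel"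
    and k: "\<And>t. \<bar>k t\<bar> \<le> c" and h: "\<And>i u. i \<in> I \<Longrightarrow> 0 \<le> u \<Longrightarrow> \<bar>h i u\<bar> \<le> d i"
  shows expectation_prod: "expectation (\<lambda>\<omega>. k (T \<omega>) * (\<Prod>i\<in>I. h i (U i \<omega>))) =
      expectation (\<lambda>\<omega>. k (T \<omega>)) * (\<Prod>i\<in>I. expectation (\<lambda>\<omega>. h i (U 0 \<omega>)))"
    and integrable_prod: "integrable M (\<lambda>\<omega>. k (T \<omega>) * (\<Prod>i\<in>I. h i (U i \<omega>)))"
proof -
  let ?J = "insert None (Some ` I)"
  define Z where "Z j \<omega> = case_option k h j (case_option T U j \<omega>)" for j \<omega>
  have Z_eq: "Z None = (\<lambda>\<omega>. k (T \<omega>))" "Z (Some i) = (\<lambda>\<omega>. h i (U i \<omega>))" for i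
    by (auto simp: Z_def)
  have "indep_vars (\<lambda>_. borel) (case_option T U) ?J"
    by (rule indep_vars_subset[OF indep]) simp
  then have indepZ: "indep_vars (\<lambda>_. borel) Z ?J"
    unfolding Z_def
    by (rule indep_vars_compose2) (auto split: option.split)
  have intZ: "integrable M (Z j)" if "j \<in> ?J" for j
  proof (cases j)
    case None
    then show ?thesis
      using k by (auto simp: Z_eq intro!: integrable_const_bound[where B = c])
  next
    case (Some i)
    then show ?thesis
      using that h[of i] U_nonneg
      by (auto simp: Z_eq intro!: integrable_const_bound[where B = "d i"])
  qed
  have split: "(\<Prod>j\<in>?J. a j) = a None * (\<Prod>i\<in>I. a (Some i))" for a :: "nat option \<Rightarrow> real"
    using \<open>finite I\<close> by (subst prod.insert) (auto simp: prod.reindex)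
  have "(\<Prod>i\<in>I. expectation (\<lambda>\<omega>. h i (U i \<omega>))) = (\<Prod>i\<in>I. expectation (\<lambda>\<omega>. h i (U 0 \<omega>)))"
    by (intro prod.cong refl expectation_U_eq) simp
  then show "expectation (\<lambda>\<omega>. k (T \<omega>) * (\<Prod>i\<in>I. h i (U i \<omega>))) =
      expectation (\<lambda>\<omega>. k (T \<omega>)) * (\<Prod>i\<in>I. expectation (\<lambda>\<omega>. h i (U 0 \<omega>)))"
    using indep_vars_lebesgue_integral[OF _ indepZ intZ] \<open>finite I\<close>
    by (simp add: split Z_eq)
  show "integrable M (\<lambda>\<omega>. k (T \<omega>) * (\<Prod>i\<in>I. h i (U i \<omega>)))"
    using indep_vars_integrable[OF _ indepZ intZ] \<open>finite I\<close>
    by (simp add: split Z_eq)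
qed

lemma failure_tail_eq_expectation:
  "failure_tail M U s = expectation (\<lambda>\<omega>. indicator {s<..} (U 0 \<omega>))"
proof -
  have "expectation (\<lambda>\<omega>. indicator {s<..} (U 0 \<omega>)) = expectation (indicator {\<omega>\<in>space M. U 0 \<omega> > s} :: _ \<Rightarrow> real)"
    by (rule Bochner_Integration.integral_cong) (auto simp: indicator_def)
  then show ?thesis
    by (simp add: failure_tail_def)
qed

lemma task_tail_eq_expectation:
  "task_tail M T s = expectation (\<lambda>\<omega>. indicator {s<..} (T \<omega>))"
proof -
  have "expectation (\<lambda>\<omega>. indicator {s<..} (T \<omega>)) = expectation (indicator {\<omega>\<in>space M. T \<omega> > s} :: _ \<Rightarrow> real)"
    by (rule Bochner_Integration.integral_cong) (auto simp: indicator_def)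
  then show ?thesis
    by (simp add: task_tail_def)
qed

lemma failure_cdf_eq_expectation:
  "1 - failure_tail M U s = expectation (\<lambda>\<omega>. indicator {..s} (U 0 \<omega>))"
proof -
  have "expectation (\<lambda>\<omega>. indicator {..s} (U 0 \<omega>)) = expectation (\<lambda>\<omega>. 1 - indicator {s<..} (U 0 \<omega>))"
    by (rule Bochner_Integration.integral_cong) (auto simp: indicator_def)
  also have "\<dots> = 1 - failure_tail M U s"
    unfolding failure_tail_eq_expectation
    by (subst Bochner_Integration.integral_diff)
       (auto simp: prob_space intro!: integrable_const_bound[where B = 1])
  finally show ?thesis ..
qed

lemma failure_tail_Markov:
  assumes "s > 0"
  shows "s * failure_tail M U s \<le> expectation (U 0)"
proof -
  have "s * failure_tail M U s = expectation (\<lambda>\<omega>. s * indicator {s<..} (U 0 \<omega>))"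
    unfolding failure_tail_eq_expectation by simp
  also have "\<dots> \<le> expectation (U 0)"
    using U_nonneg[of _ 0] assms
    by (intro integral_mono_AE U_integrable)
       (auto simp: indicator_def intro!: integrable_mult_right integrable_const_bound[where B = 1])
  finally show ?thesis .
qed

lemma failure_tail_antimono: "s \<le> t \<Longrightarrow> failure_tail M U t \<le> failure_tail M U s"
  unfolding failure_tail_def by (intro finite_measure_mono) auto

lemma task_tail_antimono: "s \<le> t \<Longrightarrow> task_tail M T t \<le> task_tail M T s"
  unfolding task_tail_def by (intro finite_measure_mono) auto

text \<open>The following descriptions turn the infimum and the case distinction in the definitions into
  countable combinations of inequalities between random variables, which gives measurability.\<close>

lemma num_failures_eq_enat_iff:
  "num_failures T U \<omega> = enat n \<longleftrightarrow> U (n + 1) \<omega> > T \<omega> \<and> (\<forall>k<n. U (k + 1) \<omega> \<le> T \<omega>)"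
  (is "_ \<longleftrightarrow> ?R")
proof
  let ?S = "{enat n |n. U (n + 1) \<omega> > T \<omega>}"
  assume eq: "num_failures T U \<omega> = enat n"
  have "?S \<noteq> {}"
  proof
    assume "?S = {}"
    with eq show False
      unfolding num_failures_def by (simp only: Inf_empty top_enat_def) simp
  qed
  then obtain m where "m \<in> ?S" by blast
  then have "Inf ?S \<in> ?S" by (rule wellorder_InfI)
  then have "enat n \<in> ?S" by (simp only: eq[unfolded num_failures_def])
  moreover have "U (k + 1) \<omega> \<le> T \<omega>" if "k < n" for k
  proof (rule ccontr)
    assume "\<not> U (k + 1) \<omega> \<le> T \<omega>"
    then have "Inf ?S \<le> enat k" by (intro Inf_lower) auto
    with eq that show False by (simp add: num_failures_def)
  qed
  ultimately show ?R by auto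
next
  assume ?R
  then have "n \<le> m" if "U (m + 1) \<omega> > T \<omega>" for m
    using that by (meson leD leI)
  with \<open>?R\<close> show "num_failures T U \<omega> = enat n"
    unfolding num_failures_def
    by (intro antisym Inf_lower Inf_greatest) auto
qed

lemma num_failures_eq_infinity_iff:
  "num_failures T U \<omega> = \<infinity> \<longleftrightarrow> (\<forall>k. U (k + 1) \<omega> \<le> T \<omega>)"
proof -
  have "num_failures T U \<omega> \<noteq> \<infinity> \<longleftrightarrow> (\<exists>k. U (k + 1) \<omega> > T \<omega>)"
  proof
    assume "num_failures T U \<omega> \<noteq> \<infinity>"
    then obtain n where "num_failures T U \<omega> = enat n" by auto
    then show "\<exists>k. U (k + 1) \<omega> > T \<omega>"
      unfolding num_failures_eq_enat_iff by blast
  next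
    assume "\<exists>k. U (k + 1) \<omega> > T \<omega>"
    then obtain k where "U (k + 1) \<omega> > T \<omega>" by auto
    then have "num_failures T U \<omega> \<le> enat k"
      unfolding num_failures_def by (intro Inf_lower) auto
    then show "num_failures T U \<omega> \<noteq> \<infinity>" by (cases "num_failures T U \<omega>") auto
  qed
  then show ?thesis by (meson leD leI)
qed

lemma total_time_gt_iff:
  "total_time T U \<omega> > ereal x \<longleftrightarrow>
     (\<forall>k. U (k + 1) \<omega> \<le> T \<omega>) \<or>
     (\<exists>n. U (n + 1) \<omega> > T \<omega> \<and> (\<forall>k<n. U (k + 1) \<omega> \<le> T \<omega>) \<and> T \<omega> + (\<Sum>i=1..n. U i \<omega>) > x)"
proof (cases "num_failures T U \<omega>")
  case (enat n)
  have "m = n" if "U (m + 1) \<omega> > T \<omega> \<and> (\<forall>k<m. U (k + 1) \<omega> \<le> T \<omega>)" for m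
    using that enat num_failures_eq_enat_iff[of \<omega> m] by simp
  moreover have "U (n + 1) \<omega> > T \<omega> \<and> (\<forall>k<n. U (k + 1) \<omega> \<le> T \<omega>)"
    using enat num_failures_eq_enat_iff by auto
  moreover from this have "\<not> (\<forall>k. U (k + 1) \<omega> \<le> T \<omega>)" by (meson leD)
  moreover have "total_time T U \<omega> > ereal x \<longleftrightarrow> T \<omega> + (\<Sum>i=1..n. U i \<omega>) > x"
    using enat by (simp add: total_time_def)
  ultimately show ?thesis by blast
next
  case infinity
  then show ?thesis
    using num_failures_eq_infinity_iff[of \<omega>] by (simp add: total_time_def)
qed

lemma total_time_event_measurable [measurable]:
  "{\<omega> \<in> space M. total_time T U \<omega> > ereal x} \<in> events"
  unfolding total_time_gt_iff by measurable

text \<open>Failures of length at most \<open>T\<close> at the beginning all count towards the total time, whether or not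
  the task is ever completed.\<close>

lemma total_time_gt_of_many_failures:
  assumes "\<omega> \<in> space M" "\<And>i. i \<in> {1..n} \<Longrightarrow> U i \<omega> \<le> T \<omega>" "(\<Sum>i=1..n. U i \<omega>) > x"
  shows "total_time T U \<omega> > ereal x"
proof (cases "num_failures T U \<omega>")
  case (enat m)
  then have "U (m + 1) \<omega> > T \<omega>" using num_failures_eq_enat_iff by auto
  then have "n \<le> m"
    using assms(2)[of "m + 1"] by force
  then have "(\<Sum>i=1..n. U i \<omega>) \<le> (\<Sum>i=1..m. U i \<omega>)"
    using U_nonneg assms(1) by (intro sum_mono2) auto
  then show ?thesis
    using assms(3) T_nonneg[OF assms(1)] enat by (simp add: total_time_def)
next
  case infinity
  then show ?thesis by (simp add: total_time_def)
qed

section \<open>Lower bound for the tail of the total time\<close>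

lemma failure_tail_tendsto_0: "(failure_tail M U \<longlongrightarrow> 0) at_top"
proof (rule real_tendsto_sandwich)
  show "\<forall>\<^sub>F s in at_top. 0 \<le> failure_tail M U s"
    by (simp add: failure_tail_def)
  show "\<forall>\<^sub>F s in at_top. failure_tail M U s \<le> expectation (U 0) / s"
    using eventually_gt_at_top[of 0]
    by eventually_elim (use failure_tail_Markov in \<open>simp add: field_simps\<close>)
  show "((\<lambda>s. expectation (U 0) / s) \<longlongrightarrow> 0) at_top"
    by (rule tendsto_divide_0[OF tendsto_const filterlim_at_top_imp_at_infinity[OF filterlim_ident]])
qed simp

lemma expectation_U_pos:
  assumes "failure_tail M U 1 > 0"
  shows "expectation (U 0) > 0"
  using failure_tail_Markov[of 1] assms by simp

lemma Laplace_transform_less_1: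
  assumes "failure_tail M U 1 > 0"
  shows "expectation (\<lambda>\<omega>. exp (- U 0 \<omega>)) < 1"
proof -
  have ind: "integrable M (\<lambda>\<omega>. indicator {1<..} (U 0 \<omega>) :: real)"
    by (auto intro!: integrable_const_bound[where B = 1])
  have "expectation (\<lambda>\<omega>. exp (- U 0 \<omega>)) \<le>
      expectation (\<lambda>\<omega>. 1 - (1 - exp (- 1)) * indicator {1<..} (U 0 \<omega>))"
    using U_nonneg[of _ 0] ind
    by (intro integral_mono_AE)
       (auto simp: indicator_def intro!: integrable_const_bound[where B = 1])
  also have "\<dots> = 1 - (1 - exp (- 1)) * failure_tail M U 1"
    unfolding failure_tail_eq_expectation using ind by (simp add: prob_space)
  also have "\<dots> < 1"
    using assms by simp
  finally show ?thesis .
qed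

text \<open>The good event is \<open>T > s\<close> together with \<open>n\<close> initial failures of length at most \<open>s\<close>. Subtracted is
  the part of it on which these failures add up to at most \<open>x\<close>; there the constraint \<open>U \<le> s\<close> is dropped
  and Markov's inequality is applied to \<open>exp (- (U 1 + \<dots> + U n))\<close>.\<close>

lemma total_time_tail_ge_power:
  "total_time_tail M T U x \<ge> task_tail M T s *
     ((1 - failure_tail M U s) ^ n - exp x * expectation (\<lambda>\<omega>. exp (- U 0 \<omega>)) ^ n)"
proof -
  define A where "A = {\<omega> \<in> space M. T \<omega> > s \<and> (\<forall>i\<in>{1..n}. U i \<omega> \<le> s)}"
  define C where "C = {\<omega> \<in> space M. T \<omega> > s \<and> (\<Sum>i=1..n. U i \<omega>) \<le> x}"
  have [measurable]: "A \<in> events" "C \<in> events"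
    unfolding A_def C_def by measurable
  have "prob A = expectation (indicator A :: _ \<Rightarrow> real)"
    by simp
  also have "\<dots> = expectation (\<lambda>\<omega>. indicator {s<..} (T \<omega>) * (\<Prod>i\<in>{1..n}. indicator {..s} (U i \<omega>)))"
    by (rule Bochner_Integration.integral_cong)
       (auto simp: indicator_def A_def not_le prod_zero_iff)
  also have "\<dots> = task_tail M T s * (1 - failure_tail M U s) ^ n"
    by (subst expectation_prod[where c = 1 and d = "\<lambda>_. 1"])
       (auto simp: task_tail_eq_expectation failure_cdf_eq_expectation)
  finally have A: "prob A = task_tail M T s * (1 - failure_tail M U s) ^ n" .
  have "prob C = expectation (indicator C :: _ \<Rightarrow> real)"
    by simp
  also have "\<dots> \<le> expectation (\<lambda>\<omega>. exp x * (indicator {s<..} (T \<omega>) * (\<Prod>i\<in>{1..n}. exp (- U i \<omega>))))"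
  proof (intro integral_mono_AE integrable_mult_right)
    show "integrable M (\<lambda>\<omega>. indicator {s<..} (T \<omega>) * (\<Prod>i\<in>{1..n}. exp (- U i \<omega>)))"
      by (rule integrable_prod[where c = 1 and d = "\<lambda>_. 1"]) auto
    show "AE \<omega> in M. indicator C \<omega> \<le> exp x * (indicator {s<..} (T \<omega>) * (\<Prod>i\<in>{1..n}. exp (- U i \<omega>)))"
      by (auto simp: C_def indicator_def sum_negf exp_add[symmetric] simp flip: exp_sum)
  qed (auto simp: emeasure_eq_measure)
  also have "\<dots> = exp x * (task_tail M T s * expectation (\<lambda>\<omega>. exp (- U 0 \<omega>)) ^ n)"
    unfolding integral_mult_right_zero
    by (subst expectation_prod[where c = 1 and d = "\<lambda>_. 1"])
       (auto simp: task_tail_eq_expectation)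
  finally have C: "prob C \<le> exp x * (task_tail M T s * expectation (\<lambda>\<omega>. exp (- U 0 \<omega>)) ^ n)" .
  have "prob A - prob C \<le> prob (A - C)"
    using finite_measure_Diff'[of A C] finite_measure_mono[of "A \<inter> C" C] by auto
  also have "prob (A - C) \<le> total_time_tail M T U x"
    unfolding total_time_tail_def
  proof (intro finite_measure_mono subsetI)
    fix \<omega> assume \<omega>: "\<omega> \<in> A - C"
    then have "s < T \<omega>" "\<forall>i\<in>{1..n}. U i \<omega> \<le> s"
      unfolding A_def by blast+
    then have "U i \<omega> \<le> T \<omega>" if "i \<in> {1..n}" for i
      using that by force
    then show "\<omega> \<in> {\<omega> \<in> space M. total_time T U \<omega> > ereal x}"
      using \<omega> total_time_gt_of_many_failures[of \<omega> n x] by (simp add: A_def C_def not_le)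
  qed measurable
  finally show ?thesis
    using A C by (simp add: algebra_simps)
qed

lemma exp_minus_double_le_one_minus:
  fixes y :: real
  assumes "0 \<le> y" "y \<le> 1 / 2"
  shows "exp (- (2 * y)) \<le> 1 - y"
proof -
  have "exp (- (2 * y)) = 1 / exp (2 * y)" by (simp add: exp_minus field_simps)
  also have "\<dots> \<le> 1 / (1 + 2 * y)"
    using assms by (intro divide_left_mono) (auto intro: exp_ge_add_one_self add_pos_nonneg)
  also have "\<dots> \<le> 1 - y"
  proof -
    have "2 * (y * y) \<le> y" using mult_left_mono[OF assms(2) assms(1)] by simp
    then show ?thesis using assms by (simp add: field_simps)
  qed
  finally show ?thesis .
qed

text \<open>Take \<open>n\<close> proportional to \<open>x\<close> in the previous lemma: the subtracted term is then at most half of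
  \<open>(1 - B s) ^ n\<close>, which in turn is at least \<open>exp (- 2 * n * B s)\<close> once \<open>B s \<le> 1 / 2\<close>.\<close>

lemma total_time_tail_lower_bound:
  assumes "failure_tail M U 1 > 0"
  obtains K t\<^sub>0 where "K > 0" and
    "\<And>x s. x \<ge> 1 \<Longrightarrow> s \<ge> t\<^sub>0 \<Longrightarrow>
       total_time_tail M T U x \<ge> 1 / 2 * task_tail M T s * exp (- K * x * failure_tail M U s)"
proof -
  define \<rho> where "\<rho> = expectation (\<lambda>\<omega>. exp (- U 0 \<omega>))"
  define r where "r = sqrt \<rho>"
  have "\<rho> < 1" unfolding \<rho>_def by (rule Laplace_transform_less_1[OF assms])
  have "\<rho> \<noteq> 0"
  proof
    assume "\<rho> = 0"
    then have "AE \<omega> in M. exp (- U 0 \<omega>) = 0"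
      unfolding \<rho>_def using U_nonneg[of _ 0]
      by (subst (asm) integral_nonneg_eq_0_iff_AE)
         (auto intro!: integrable_const_bound[where B = 1])
    then show False by (simp add: AE_False)
  qed
  moreover have "\<rho> \<ge> 0" unfolding \<rho>_def by simp
  ultimately have "\<rho> > 0" by simp
  have r: "0 < r" "r < 1" "r * r = \<rho>"
    using \<open>0 < \<rho>\<close> \<open>\<rho> < 1\<close> by (auto simp: r_def)
  define l where "l = - ln r"
  have l: "l > 0" "r = exp (- l)" using r by (auto simp: l_def)
  have "\<forall>\<^sub>F s in at_top. failure_tail M U s < min (1 / 2) (1 - r)"
    using failure_tail_tendsto_0 r by (intro order_tendstoD) auto
  then obtain t\<^sub>0 where t0: "\<And>s. s \<ge> t\<^sub>0 \<Longrightarrow> failure_tail M U s < min (1 / 2) (1 - r)"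
    by (auto simp: eventually_at_top_linorder)
  define K where "K = 2 * (2 / l + 1)"
  show ?thesis
  proof (rule that)
    show "K > 0" using l by (auto simp: K_def intro: add_pos_pos)
    fix x s :: real
    assume x: "x \<ge> 1" and "s \<ge> t\<^sub>0"
    define B where "B = failure_tail M U s"
    have B: "0 \<le> B" "B \<le> 1 / 2" "r \<le> 1 - B"
      using t0[OF \<open>s \<ge> t\<^sub>0\<close>] by (auto simp: B_def failure_tail_def)
    \<comment> \<open>The Laplace transform is the square of \<open>r = exp (- l)\<close>. One factor \<open>r\<close> is dominated by the
      probability \<open>1 - B\<close> of a short failure; \<open>n\<close> is chosen so that \<open>n\<close> powers of the other one beat
      \<open>exp x\<close>, that is, \<open>n * l \<ge> 2 * x\<close>.\<close>
    define n where "n = nat \<lceil>2 * x / l\<rceil>"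
    have n: "real n \<ge> 2 * x / l" "real n \<le> 2 * x / l + 1"
      using x l by (auto simp: n_def)
    have "exp x * r ^ n \<le> 1 / 2"
    proof -
      have "2 * x \<le> real n * l" using n l by (simp add: field_simps)
      then have "exp x * r ^ n \<le> exp (- 1)"
        using x unfolding l by (simp add: exp_of_nat_mult[symmetric] exp_add[symmetric])
      also have "\<dots> \<le> 1 / 2"
        using exp_ge_add_one_self[of 1] by (simp add: exp_minus field_simps)
      finally show ?thesis .
    qed
    then have "exp x * r ^ n * r ^ n \<le> 1 / 2 * (1 - B) ^ n"
      using B r by (intro mult_mono power_mono) auto
    then have "exp x * \<rho> ^ n \<le> 1 / 2 * (1 - B) ^ n"
      by (simp add: r(3)[symmetric] power_mult_distrib mult.assoc)
    then have "1 / 2 * (1 - B) ^ n \<le> (1 - B) ^ n - exp x * \<rho> ^ n"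
      by simp
    moreover have "exp (- K * x * B) \<le> (1 - B) ^ n"
    proof -
      have "real n \<le> (2 / l + 1) * x" using n x by (simp add: algebra_simps)
      then have "2 * real n \<le> K * x"
        unfolding K_def mult.assoc by (rule mult_left_mono) simp
      then have "2 * real n * B \<le> K * x * B"
        using B by (intro mult_right_mono) auto
      then have "exp (- K * x * B) \<le> exp (- (2 * B)) ^ n"
        by (simp add: exp_of_nat_mult[symmetric] mult_ac)
      also have "\<dots> \<le> (1 - B) ^ n"
        using exp_minus_double_le_one_minus B by (intro power_mono) auto
      finally show ?thesis .
    qed
    ultimately have "1 / 2 * exp (- K * x * B) \<le> (1 - B) ^ n - exp x * \<rho> ^ n"
      by linarith
    then have "task_tail M T s * (1 / 2 * exp (- K * x * B)) \<le> task_tail M T s * ((1 - B) ^ n - exp x * \<rho> ^ n)"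
      by (intro mult_left_mono) (auto simp: task_tail_def)
    also have "\<dots> \<le> total_time_tail M T U x"
      unfolding B_def \<rho>_def by (rule total_time_tail_ge_power)
    finally show "1 / 2 * task_tail M T s * exp (- K * x * failure_tail M U s) \<le> total_time_tail M T U x"
      by (simp add: B_def mult_ac)
  qed
qed

section \<open>Upper bound for the tail of the total time\<close>

text \<open>Truncation at \<open>s \<le> 1 / \<theta>\<close> keeps the exponent in \<open>[0, 1]\<close>, where \<open>exp y \<le> 1 + 2 * y\<close>; so the first
  moment of \<open>U\<close> suffices although \<open>U\<close> itself may have no exponential moments.\<close>

lemma truncated_exponential_moment_le:
  assumes "\<theta> \<ge> 0" "\<theta> * s \<le> 1"
  shows "expectation (\<lambda>\<omega>. exp (\<theta> * U 0 \<omega>) * indicator {..s} (U 0 \<omega>)) \<le>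
    1 - failure_tail M U s + 2 * \<theta> * expectation (U 0)"
proof -
  have exp_le: "exp y \<le> 1 + 2 * y" if "0 \<le> y" "y \<le> 1" for y :: real
  proof -
    have "exp y \<le> 1 + y + y\<^sup>2" using exp_bound that by simp
    also have "y\<^sup>2 \<le> y" using that by (simp add: power2_eq_square mult_left_le)
    finally show ?thesis by simp
  qed
  have ind: "integrable M (\<lambda>\<omega>. indicator {..s} (U 0 \<omega>) :: real)"
    by (auto intro!: integrable_const_bound[where B = 1])
  have "expectation (\<lambda>\<omega>. exp (\<theta> * U 0 \<omega>) * indicator {..s} (U 0 \<omega>)) \<le>
      expectation (\<lambda>\<omega>. indicator {..s} (U 0 \<omega>) + 2 * \<theta> * U 0 \<omega>)"
  proof (rule integral_mono_AE)
    have le: "\<theta> * U 0 \<omega> \<le> 1" if "\<omega> \<in> space M" "U 0 \<omega> \<le> s" for \<omega>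
      using mult_left_mono[OF that(2) assms(1)] assms(2) by simp
    show "integrable M (\<lambda>\<omega>. exp (\<theta> * U 0 \<omega>) * indicator {..s} (U 0 \<omega>))"
      using le by (intro integrable_const_bound[where B = "exp 1"]) (auto simp: indicator_def)
    show "AE \<omega> in M. exp (\<theta> * U 0 \<omega>) * indicator {..s} (U 0 \<omega>) \<le>
        indicator {..s} (U 0 \<omega>) + 2 * \<theta> * U 0 \<omega>"
      using le U_nonneg[of _ 0] assms exp_le[of "\<theta> * U 0 _"]
      by (auto simp: indicator_def mult.assoc)
    show "integrable M (\<lambda>\<omega>. indicator {..s} (U 0 \<omega>) + 2 * \<theta> * U 0 \<omega>)"
      using ind U_integrable by auto
  qed
  also have "\<dots> = 1 - failure_tail M U s + 2 * \<theta> * expectation (U 0)"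
    using ind U_integrable by (simp add: failure_cdf_eq_expectation)
  finally show ?thesis .
qed

text \<open>A Chernoff bound for the run of \<open>n\<close> failures that precedes the first one exceeding \<open>s\<close>. The
  factor \<open>failure_tail M U s\<close> for the terminating failure cancels the factor \<open>1 / failure_tail M U s\<close>
  that the summation over \<open>n\<close> produces later.\<close>

lemma prob_failure_run_le:
  assumes "\<theta> \<ge> 0" "s \<ge> 0"
  shows "prob {\<omega> \<in> space M. (\<forall>i\<in>{1..n}. U i \<omega> \<le> s) \<and> U (Suc n) \<omega> > s \<and> (\<Sum>i=1..n. U i \<omega>) > y} \<le>
    exp (- \<theta> * y) * failure_tail M U s *
      expectation (\<lambda>\<omega>. exp (\<theta> * U 0 \<omega>) * indicator {..s} (U 0 \<omega>)) ^ n"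
    (is "prob ?E \<le> _")
proof -
  have [measurable]: "?E \<in> events" by measurable
  define h :: "nat \<Rightarrow> real \<Rightarrow> real" where
    "h i u = (if i \<le> n then exp (\<theta> * u) * indicator {..s} u else indicator {s<..} u)" for i u
  have h_meas [measurable]: "h i \<in> borel_measurable borel" for i
    unfolding h_def by measurable
  have h_bound: "\<bar>h i u\<bar> \<le> exp (\<theta> * s)" if "0 \<le> u" for i u
    using assms by (auto simp: h_def indicator_def mult_left_mono)
  have prod_h: "(\<Prod>i\<in>{1..Suc n}. h i (v i)) =
      (\<Prod>i\<in>{1..n}. exp (\<theta> * v i) * indicator {..s} (v i)) * indicator {s<..} (v (Suc n))"
    for v :: "nat \<Rightarrow> real"
    by (simp add: h_def)
  have "prob ?E = expectation (indicator ?E :: _ \<Rightarrow> real)"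
    by simp
  also have "\<dots> \<le> expectation (\<lambda>\<omega>. exp (- \<theta> * y) * (\<Prod>i\<in>{1..Suc n}. h i (U i \<omega>)))"
  proof (intro integral_mono_AE integrable_mult_right)
    show "integrable M (\<lambda>\<omega>. \<Prod>i\<in>{1..Suc n}. h i (U i \<omega>))"
      using integrable_prod[where k = "\<lambda>_. 1" and c = 1 and h = h and d = "\<lambda>_. exp (\<theta> * s)"
          and I = "{1..Suc n}"] h_bound
      by simp
    have "(1::real) \<le> exp (- \<theta> * y) * (\<Prod>i\<in>{1..n}. exp (\<theta> * U i \<omega>))" if "\<omega> \<in> ?E" for \<omega>
    proof -
      have "\<theta> * y \<le> \<theta> * (\<Sum>i=1..n. U i \<omega>)"
        using that assms by (intro mult_left_mono) auto
      then show ?thesis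
        by (simp add: exp_sum[symmetric] exp_add[symmetric] sum_distrib_left)
    qed
    then show "AE \<omega> in M. indicator ?E \<omega> \<le> exp (- \<theta> * y) * (\<Prod>i\<in>{1..Suc n}. h i (U i \<omega>))"
      unfolding prod_h by (auto simp: indicator_def intro!: mult_nonneg_nonneg prod_nonneg)
  qed (auto simp: emeasure_eq_measure)
  also have "\<dots> = exp (- \<theta> * y) * (\<Prod>i\<in>{1..Suc n}. expectation (\<lambda>\<omega>. h i (U 0 \<omega>)))"
    using expectation_prod[where k = "\<lambda>_. 1" and c = 1 and h = h and d = "\<lambda>_. exp (\<theta> * s)" and I = "{1..Suc n}"] h_bound
    by (simp add: prob_space)
  also have "(\<Prod>i\<in>{1..Suc n}. expectation (\<lambda>\<omega>. h i (U 0 \<omega>))) =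
      expectation (\<lambda>\<omega>. exp (\<theta> * U 0 \<omega>) * indicator {..s} (U 0 \<omega>)) ^ n * failure_tail M U s"
    by (simp add: h_def failure_tail_eq_expectation)
  finally show ?thesis by (simp add: mult_ac)
qed

text \<open>Replacing \<open>T\<close> by the larger threshold \<open>s\<close> can only lengthen the initial run of failures, so a large
  total time forces a large sum over the run that ends at the first failure exceeding \<open>s\<close>.\<close>

lemma total_time_gt_cases:
  assumes "\<omega> \<in> space M" "total_time T U \<omega> > ereal x" "T \<omega> \<le> s" "s \<le> x / 2"
    and "U (k + 1) \<omega> > s"
  shows "\<exists>n. (\<forall>i\<in>{1..n}. U i \<omega> \<le> s) \<and> U (Suc n) \<omega> > s \<and> (\<Sum>i=1..n. U i \<omega>) > x / 2"
proof -
  define m where "m = (LEAST m. U (Suc m) \<omega> > s)"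
  have m: "U (Suc m) \<omega> > s"
    unfolding m_def by (rule LeastI[of _ k]) (use assms in simp)
  have le: "U i \<omega> \<le> s" if "i \<in> {1..m}" for i
    using not_less_Least[of "i - 1" "\<lambda>m. U (Suc m) \<omega> > s"] that
    by (cases i) (auto simp: m_def not_less)
  obtain n where n: "\<forall>k<n. U (k + 1) \<omega> \<le> T \<omega>" "T \<omega> + (\<Sum>i=1..n. U i \<omega>) > x"
    using assms(2,3,5) unfolding total_time_gt_iff by (meson leD le_less_trans)
  have "n \<le> m"
    using n(1) m assms(3) by (metis Suc_eq_plus1 leI le_less_trans leD)
  then have "(\<Sum>i=1..n. U i \<omega>) \<le> (\<Sum>i=1..m. U i \<omega>)"
    using U_nonneg assms(1) by (intro sum_mono2) auto
  then have "(\<Sum>i=1..m. U i \<omega>) > x / 2"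
    using n(2) assms(3,4) by linarith
  with m le show ?thesis by blast
qed

lemma AE_failure_exceeds:
  assumes "failure_tail M U s > 0"
  shows "AE \<omega> in M. \<exists>k. U (k + 1) \<omega> > s"
proof -
  let ?A = "{\<omega> \<in> space M. \<forall>k. U (k + 1) \<omega> \<le> s}"
  have [measurable]: "?A \<in> events" by measurable
  have le: "prob ?A \<le> (1 - failure_tail M U s) ^ n" for n
  proof -
    have "prob ?A \<le> prob {\<omega> \<in> space M. \<forall>i\<in>{1..n}. U i \<omega> \<le> s}"
    proof (intro finite_measure_mono subsetI)
      fix \<omega> assume "\<omega> \<in> ?A"
      then have "U i \<omega> \<le> s" if "i \<in> {1..n}" for i
        using that by (cases i) auto
      with \<open>\<omega> \<in> ?A\<close> show "\<omega> \<in> {\<omega> \<in> space M. \<forall>i\<in>{1..n}. U i \<omega> \<le> s}" by auto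
    qed measurable
    also have "\<dots> = expectation (indicator {\<omega> \<in> space M. \<forall>i\<in>{1..n}. U i \<omega> \<le> s} :: _ \<Rightarrow> real)"
      by simp
    also have "\<dots> = expectation (\<lambda>\<omega>. 1 * (\<Prod>i\<in>{1..n}. indicator {..s} (U i \<omega>)))"
      by (rule Bochner_Integration.integral_cong) (auto simp: indicator_def prod_zero_iff)
    also have "\<dots> = (1 - failure_tail M U s) ^ n"
      by (subst expectation_prod[where k = "\<lambda>_. 1" and c = 1 and d = "\<lambda>_. 1"])
         (auto simp: failure_cdf_eq_expectation prob_space)
    finally show ?thesis .
  qed
  have "failure_tail M U s \<le> 1" by (simp add: failure_tail_def)
  then have "(\<lambda>n. (1 - failure_tail M U s) ^ n) \<longlonglongrightarrow> 0"
    using assms by (intro LIMSEQ_realpow_zero) auto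
  then have "prob ?A \<le> 0"
    using le by (intro LIMSEQ_le_const) auto
  then have "AE \<omega> in M. \<omega> \<notin> ?A"
    by (simp add: measure_le_0_iff AE_iff_measurable[of ?A] emeasure_eq_measure)
  then show ?thesis
    using AE_space by eventually_elim (auto simp: not_le)
qed

text \<open>With \<open>\<theta> = B / (4 * E U)\<close> the truncated moment is at most \<open>1 - B / 2\<close>, so the run bounds sum to
  \<open>B / (1 - q) \<le> 2\<close> times \<open>exp (- \<theta> * x / 2)\<close>. Markov's inequality \<open>s * B \<le> E U\<close> is what makes
  this \<open>\<theta>\<close> admissible for truncation at \<open>s\<close>.\<close>

lemma total_time_tail_upper_bound:
  assumes pos: "\<And>t. failure_tail M U t > 0" and "0 < s" "s \<le> x / 2"
  shows "total_time_tail M T U x \<le>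
    task_tail M T s + 2 * exp (- (1 / (8 * expectation (U 0))) * x * failure_tail M U s)"
proof -
  define m where "m = expectation (U 0)"
  define B where "B = failure_tail M U s"
  define \<theta> where "\<theta> = B / (4 * m)"
  define q where "q = expectation (\<lambda>\<omega>. exp (\<theta> * U 0 \<omega>) * indicator {..s} (U 0 \<omega>))"
  have "m > 0" unfolding m_def by (rule expectation_U_pos[OF pos])
  have B: "0 < B" "B \<le> 1" using pos by (auto simp: B_def failure_tail_def)
  have "s * B \<le> m" unfolding m_def B_def by (rule failure_tail_Markov[OF \<open>0 < s\<close>])
  then have \<theta>: "\<theta> \<ge> 0" "\<theta> * s \<le> 1"
    using \<open>m > 0\<close> B by (auto simp: \<theta>_def field_simps)
  have q: "0 \<le> q" "q \<le> 1 - B / 2"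
  proof -
    show "0 \<le> q" unfolding q_def by simp
    have "q \<le> 1 - B + 2 * \<theta> * m"
      unfolding q_def B_def m_def by (rule truncated_exponential_moment_le[OF \<theta>])
    then show "q \<le> 1 - B / 2" using \<open>m > 0\<close> by (simp add: \<theta>_def)
  qed
  then have "q < 1" using B by simp
  define E where "E n = {\<omega> \<in> space M. (\<forall>i\<in>{1..n}. U i \<omega> \<le> s) \<and> U (Suc n) \<omega> > s \<and> (\<Sum>i=1..n. U i \<omega>) > x / 2}" for n
  have E_meas [measurable]: "E n \<in> events" for n unfolding E_def by measurable
  define D where "D = {\<omega> \<in> space M. T \<omega> > s}"
  have D_meas [measurable]: "D \<in> events" unfolding D_def by measurable
  have E_le: "prob (E n) \<le> exp (- \<theta> * (x / 2)) * B * q ^ n" for n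
    unfolding E_def B_def q_def using \<theta> \<open>0 < s\<close> by (intro prob_failure_run_le) auto
  have summable: "summable (\<lambda>n. exp (- \<theta> * (x / 2)) * B * q ^ n)"
    using q \<open>q < 1\<close> by (intro summable_mult summable_geometric) auto
  have "total_time_tail M T U x \<le> prob (D \<union> (\<Union>n. E n))"
    unfolding total_time_tail_def
  proof (rule finite_measure_mono_AE)
    show "AE \<omega> in M. \<omega> \<in> {\<omega> \<in> space M. total_time T U \<omega> > ereal x} \<longrightarrow> \<omega> \<in> D \<union> (\<Union>n. E n)"
      using AE_failure_exceeds[OF pos[of s]]
    proof eventually_elim
      case (elim \<omega>)
      then show ?case
        using total_time_gt_cases[of \<omega> x s] assms(3) by (force simp: D_def E_def not_less)
    qed
  qed measurable
  also have "\<dots> \<le> prob D + prob (\<Union>n. E n)"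
    by (intro measure_Un_le) auto
  also have "prob (\<Union>n. E n) \<le> (\<Sum>n. prob (E n))"
    using E_le by (intro finite_measure_subadditive_countably summable_comparison_test[OF _ summable]) auto
  also have "\<dots> \<le> (\<Sum>n. exp (- \<theta> * (x / 2)) * B * q ^ n)"
    using E_le by (intro suminf_le summable summable_comparison_test[OF _ summable]) auto
  also have "\<dots> = exp (- \<theta> * (x / 2)) * (B / (1 - q))"
    using q \<open>q < 1\<close> summable_geometric[of q] by (simp add: suminf_mult suminf_geometric)
  also have "\<dots> \<le> exp (- \<theta> * (x / 2)) * 2"
    using q B \<open>q < 1\<close> by (intro mult_left_mono) (auto simp: field_simps)
  finally show ?thesis
    by (simp add: D_def task_tail_def \<theta>_def m_def B_def algebra_simps)
qed

end

section \<open>From the density to the tail of the task time\<close>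

lemma ratio_tendsto_1I:
  fixes p q :: "real \<Rightarrow> real"
  assumes q: "\<forall>\<^sub>F x in at_top. q x > 0"
    and le: "\<And>e. 0 < e \<Longrightarrow> e < 1 \<Longrightarrow> \<forall>\<^sub>F x in at_top. p x \<le> (1 + e) * q x"
    and ge: "\<And>e. 0 < e \<Longrightarrow> e < 1 \<Longrightarrow> \<forall>\<^sub>F x in at_top. p x \<ge> (1 - e) * q x"
  shows "((\<lambda>x. p x / q x) \<longlongrightarrow> 1) at_top"
proof (rule tendstoI)
  fix e :: real assume "e > 0"
  define d where "d = min (e / 2) (1 / 2)"
  have d: "0 < d" "d < 1" "d < e" using \<open>e > 0\<close> by (auto simp: d_def min_def)
  show "\<forall>\<^sub>F x in at_top. dist (p x / q x) 1 < e"
    using q le[OF d(1,2)] ge[OF d(1,2)]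
  proof eventually_elim
    case (elim x)
    then have "p x / q x \<le> 1 + d" "1 - d \<le> p x / q x"
      by (auto simp: field_simps)
    with d show ?case by (auto simp: dist_real_def)
  qed
qed

lemma ratio_tendsto_1D:
  fixes p q :: "real \<Rightarrow> real"
  assumes lim: "((\<lambda>x. p x / q x) \<longlongrightarrow> 1) at_top" and q: "\<forall>\<^sub>F x in at_top. q x > 0" and "e > 0"
  shows "\<forall>\<^sub>F x in at_top. (1 - e) * q x \<le> p x \<and> p x \<le> (1 + e) * q x"
proof -
  have "\<forall>\<^sub>F x in at_top. 1 - e < p x / q x" "\<forall>\<^sub>F x in at_top. p x / q x < 1 + e"
    using \<open>e > 0\<close> by (auto intro!: order_tendstoD[OF lim])
  then show ?thesis
    using q by eventually_elim (simp add: field_simps)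
qed

context restart_model
begin

lemma nn_integral_task_tail:
  assumes "s \<ge> 0"
  shows "ennreal (task_tail M T s) = (\<integral>\<^sup>+t. ennreal (f t * indicator {0..} t) * indicator {s<..} t \<partial>lborel)"
proof -
  have "{\<omega> \<in> space M. T \<omega> > s} = T -` {s<..} \<inter> space M" by auto
  then show ?thesis
    using distributed_emeasure[OF T_density, of "{s<..}"]
    by (simp add: task_tail_def emeasure_eq_measure)
qed

lemma task_tail_le_powr:
  assumes "s > 0" "A \<ge> 0" "\<delta> > 0" and le: "\<And>t. t \<ge> s \<Longrightarrow> f t \<le> A * t powr (- (1 + \<delta>))"
  shows "task_tail M T s \<le> A * s powr (- \<delta>) / \<delta>"
proof -
  let ?h = "\<lambda>t. A * t powr (- (1 + \<delta>))"
  let ?H = "\<lambda>t. - (A / \<delta>) * t powr (- \<delta>)"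
  have "ennreal (task_tail M T s) \<le> (\<integral>\<^sup>+t. ennreal (?h t) * indicator {s..} t \<partial>lborel)"
    unfolding nn_integral_task_tail[OF less_imp_le[OF \<open>s > 0\<close>]]
    using le assms by (intro nn_integral_mono) (auto simp: indicator_def intro!: ennreal_leI)
  also have "\<dots> = ennreal (0 - ?H s)"
  proof (rule nn_integral_FTC_atLeast)
    show "DERIV ?H t :> ?h t" if "s \<le> t" for t
      using that assms by (auto intro!: derivative_eq_intros simp: powr_diff powr_minus powr_add field_simps)
    show "(?H \<longlongrightarrow> 0) at_top"
      using \<open>\<delta> > 0\<close> tendsto_mult_right_zero[OF tendsto_neg_powr[OF _ filterlim_ident, of "- \<delta>"], of "- (A / \<delta>)"]
      by simp
  qed (use assms in auto)
  finally show ?thesis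
    using assms by simp
qed

lemma task_tail_ge:
  assumes "0 \<le> s" "s \<le> r" "0 \<le> L" and ge: "\<And>t. s \<le> t \<Longrightarrow> t \<le> r \<Longrightarrow> L \<le> f t"
  shows "(r - s) * L \<le> task_tail M T s"
proof -
  have "ennreal ((r - s) * L) = (\<integral>\<^sup>+t. ennreal L * indicator {s<..r} t \<partial>lborel)"
    using assms by (subst nn_integral_cmult_indicator) (auto simp: ennreal_mult' mult.commute)
  also have "\<dots> \<le> ennreal (task_tail M T s)"
    unfolding nn_integral_task_tail[OF \<open>0 \<le> s\<close>]
    using ge assms by (intro nn_integral_mono) (auto simp: indicator_def intro!: ennreal_leI)
  finally show ?thesis
    by (simp add: task_tail_def)
qed

lemma task_tail_pos_of_density:
  assumes "\<forall>\<^sub>F t in at_top. f t > 0"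
  shows "task_tail M T s > 0"
proof -
  obtain a where a: "\<And>t. t \<ge> a \<Longrightarrow> f t > 0"
    using assms by (auto simp: eventually_at_top_linorder)
  define b where "b = max a (max s 0)"
  have "task_tail M T b \<noteq> 0"
  proof
    assume "task_tail M T b = 0"
    then have "(\<integral>\<^sup>+t. ennreal (f t * indicator {0..} t) * indicator {b<..} t \<partial>lborel) = 0"
      using nn_integral_task_tail[of b] by (simp add: b_def)
    then have "AE t in lborel. ennreal (f t * indicator {0..} t) * indicator {b<..} t = 0"
      using distributed_borel_measurable[OF T_density]
      by (subst (asm) nn_integral_0_iff_AE) auto
    then have "AE t in lborel. t \<notin> {b<..b+1}"
    proof eventually_elim
      case (elim t)
      then show ?case using a[of t] by (auto simp: b_def indicator_def split: if_splits)
    qed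
    then have "emeasure lborel {b<..b+1} = 0"
      by (subst (asm) AE_iff_measurable[of "{b<..b+1}"]) auto
    then show False by simp
  qed
  then have "0 < task_tail M T b"
    by (simp add: task_tail_def zero_less_measure_iff)
  also have "\<dots> \<le> task_tail M T s"
    by (rule task_tail_antimono) (simp add: b_def)
  finally show ?thesis .
qed

text \<open>From below, integrate over \<open>[s, s + 1]\<close>, since \<open>(s + 1) powr \<eta>\<close> is asymptotic to \<open>s powr \<eta>\<close>. From
  above, spend a small part of the exponent on the integrable factor \<open>t powr (- 2)\<close> and bound the rest
  by its value at \<open>s\<close>.\<close>

lemma task_tail_asymp_exp:
  assumes f: "f \<approx>\<^sub>l\<^sub>o\<^sub>g (\<lambda>t. exp (- \<alpha> * t powr \<eta>))" and "\<alpha> > 0" "\<eta> > 0"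
  shows "((\<lambda>t. - ln (task_tail M T t) / (\<alpha> * t powr \<eta>)) \<longlongrightarrow> 1) at_top"
proof (rule ratio_tendsto_1I)
  have f_pos: "\<forall>\<^sub>F t in at_top. f t > 0"
    using f by (auto simp: log_equiv_def tends_to_zero_positively_def)
  note pos = task_tail_pos_of_density[OF f_pos]
  show ev_pos: "\<forall>\<^sub>F t in at_top. 0 < \<alpha> * t powr \<eta>"
    using eventually_gt_at_top[of 0] by eventually_elim (use \<open>\<alpha> > 0\<close> in simp)
  have lim: "((\<lambda>t. - ln (f t) / (\<alpha> * t powr \<eta>)) \<longlongrightarrow> 1) at_top"
    using f by (simp add: log_equiv_def)
  fix e :: real assume e: "0 < e" "e < 1"
  note bounds = ratio_tendsto_1D[OF lim ev_pos half_gt_zero[OF e(1)]]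
  show "\<forall>\<^sub>F s in at_top. - ln (task_tail M T s) \<le> (1 + e) * (\<alpha> * s powr \<eta>)"
  proof -
    have "\<forall>\<^sub>F t in at_top. exp (- (1 + e / 2) * (\<alpha> * t powr \<eta>)) \<le> f t"
      using bounds f_pos
    proof eventually_elim
      case (elim t)
      then have "exp (- (1 + e / 2) * (\<alpha> * t powr \<eta>)) \<le> exp (ln (f t))"
        by (subst exp_le_cancel_iff) linarith
      then show ?case using elim by simp
    qed
    then obtain a where a: "\<And>t. t \<ge> a \<Longrightarrow> exp (- (1 + e / 2) * (\<alpha> * t powr \<eta>)) \<le> f t"
      by (auto simp: eventually_at_top_linorder)
    have "\<forall>\<^sub>F s in at_top. (1 + e / 2) * (s + 1) powr \<eta> \<le> (1 + e) * s powr \<eta>"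
      using e \<open>\<eta> > 0\<close> by real_asymp
    then show ?thesis
      using eventually_ge_at_top[of "max a 0"]
    proof eventually_elim
      case (elim s)
      have "exp (- (1 + e / 2) * (\<alpha> * (s + 1) powr \<eta>)) \<le> f t" if "s \<le> t" "t \<le> s + 1" for t
      proof -
        have "exp (- (1 + e / 2) * (\<alpha> * (s + 1) powr \<eta>)) \<le> exp (- (1 + e / 2) * (\<alpha> * t powr \<eta>))"
          using that elim e assms by (auto intro!: mult_left_mono powr_mono2)
        also have "\<dots> \<le> f t" using a that elim by simp
        finally show ?thesis .
      qed
      then have "(s + 1 - s) * exp (- (1 + e / 2) * (\<alpha> * (s + 1) powr \<eta>)) \<le> task_tail M T s"
        using elim by (intro task_tail_ge) auto
      then have "ln (exp (- (1 + e / 2) * (\<alpha> * (s + 1) powr \<eta>))) \<le> ln (task_tail M T s)"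
        using pos[of s] by (subst ln_le_cancel_iff) auto
      then have "- ((1 + e / 2) * (\<alpha> * (s + 1) powr \<eta>)) \<le> ln (task_tail M T s)"
        unfolding ln_exp by linarith
      moreover have "(1 + e / 2) * (\<alpha> * (s + 1) powr \<eta>) \<le> (1 + e) * (\<alpha> * s powr \<eta>)"
        using mult_left_mono[OF elim(1), of \<alpha>] \<open>\<alpha> > 0\<close> by (simp add: mult_ac)
      ultimately show ?case by linarith
    qed
  qed
  show "\<forall>\<^sub>F s in at_top. - ln (task_tail M T s) \<ge> (1 - e) * (\<alpha> * s powr \<eta>)"
  proof -
    have "\<forall>\<^sub>F t in at_top. f t \<le> exp (- (1 - e / 2) * (\<alpha> * t powr \<eta>))"
      using bounds f_pos
    proof eventually_elim
      case (elim t)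
      then have "exp (ln (f t)) \<le> exp (- (1 - e / 2) * (\<alpha> * t powr \<eta>))"
        by (subst exp_le_cancel_iff) linarith
      then show ?case using elim by simp
    qed
    moreover have "\<forall>\<^sub>F t in at_top. exp (- (e / 2) * (\<alpha> * t powr \<eta>)) \<le> t powr (- (1 + 1))"
      using e assms by real_asymp
    ultimately have "\<forall>\<^sub>F t in at_top. f t \<le> exp (- (1 - e) * (\<alpha> * t powr \<eta>)) * t powr (- (1 + 1))"
    proof eventually_elim
      case (elim t)
      have "f t \<le> exp (- (1 - e) * (\<alpha> * t powr \<eta>)) * exp (- (e / 2) * (\<alpha> * t powr \<eta>))"
        using elim(1) by (simp add: exp_add[symmetric] algebra_simps)
      also have "\<dots> \<le> exp (- (1 - e) * (\<alpha> * t powr \<eta>)) * t powr (- (1 + 1))"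
        using elim(2) by (intro mult_left_mono) auto
      finally show ?case .
    qed
    then obtain a where a: "\<And>t. t \<ge> a \<Longrightarrow> f t \<le> exp (- (1 - e) * (\<alpha> * t powr \<eta>)) * t powr (- (1 + 1))"
      by (auto simp: eventually_at_top_linorder)
    show ?thesis
      using eventually_ge_at_top[of "max a 1"]
    proof eventually_elim
      case (elim s)
      have "f t \<le> exp (- (1 - e) * (\<alpha> * s powr \<eta>)) * t powr (- (1 + 1))" if "s \<le> t" for t
      proof -
        have "exp (- (1 - e) * (\<alpha> * t powr \<eta>)) \<le> exp (- (1 - e) * (\<alpha> * s powr \<eta>))"
          using that elim e assms by (auto intro!: mult_left_mono powr_mono2)
        then show ?thesis
          using a[of t] that elim by (auto intro: order_trans mult_right_mono)
      qed
      then have "task_tail M T s \<le> exp (- (1 - e) * (\<alpha> * s powr \<eta>)) * s powr (- 1) / 1"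
        using elim by (intro task_tail_le_powr) auto
      also have "\<dots> \<le> exp (- (1 - e) * (\<alpha> * s powr \<eta>))"
        using elim by (simp add: powr_minus field_simps)
      finally have "ln (task_tail M T s) \<le> ln (exp (- (1 - e) * (\<alpha> * s powr \<eta>)))"
        using pos[of s] by (subst ln_le_cancel_iff) auto
      then show ?case unfolding ln_exp by linarith
    qed
  qed
qed

text \<open>Here integration over \<open>[s, 2 * s]\<close> contributes the factor \<open>s\<close> that lowers the exponent from
  \<open>\<alpha> + 1\<close> to \<open>\<alpha>\<close>; an interval of length one would lose it.\<close>

lemma task_tail_asymp_powr:
  assumes f: "f \<approx>\<^sub>l\<^sub>o\<^sub>g (\<lambda>t. t powr (- (\<alpha> + 1)))" and "\<alpha> > 0"
  shows "((\<lambda>t. - ln (task_tail M T t) / (\<alpha> * ln t)) \<longlongrightarrow> 1) at_top"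
proof (rule ratio_tendsto_1I)
  have f_pos: "\<forall>\<^sub>F t in at_top. f t > 0"
    using f by (auto simp: log_equiv_def tends_to_zero_positively_def)
  note pos = task_tail_pos_of_density[OF f_pos]
  show "\<forall>\<^sub>F t in at_top. 0 < \<alpha> * ln t"
    using eventually_gt_at_top[of 1] by eventually_elim (use \<open>\<alpha> > 0\<close> in simp)
  have ev_pos: "\<forall>\<^sub>F t in at_top. 0 < (\<alpha> + 1) * ln t"
    using eventually_gt_at_top[of 1] by eventually_elim (use \<open>\<alpha> > 0\<close> in simp)
  have "((\<lambda>t. ln (f t) / ln (t powr (- (\<alpha> + 1)))) \<longlongrightarrow> 1) at_top"
    using f by (simp add: log_equiv_def)
  moreover have "\<forall>\<^sub>F t in at_top. ln (f t) / ln (t powr (- (\<alpha> + 1))) = - ln (f t) / ((\<alpha> + 1) * ln t)"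
    using eventually_gt_at_top[of 0]
  proof eventually_elim
    case (elim t)
    then have "ln (t powr (- (\<alpha> + 1))) = - ((\<alpha> + 1) * ln t)" by (simp add: ln_powr algebra_simps)
    then show ?case by (simp only: divide_minus_right minus_divide_left)
  qed
  ultimately have lim: "((\<lambda>t. - ln (f t) / ((\<alpha> + 1) * ln t)) \<longlongrightarrow> 1) at_top"
    by (rule Lim_transform_eventually)
  note bounds = ratio_tendsto_1D[OF lim ev_pos]
  fix e :: real assume e: "0 < e" "e < 1"
  \<comment> \<open>The relative error \<open>d\<close> for the density refers to the exponent \<open>\<alpha> + 1\<close>; it is chosen so that the
    absolute error in the exponent is half of the allowed \<open>e * \<alpha>\<close>.\<close>
  define d where "d = e * \<alpha> / (2 * (\<alpha> + 1))"
  have d: "d > 0" "(\<alpha> + 1) * d = e * \<alpha> / 2" using e \<open>\<alpha> > 0\<close> by (simp_all add: d_def divide_simps)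
  have e\<alpha>: "0 < e * \<alpha>" using e \<open>\<alpha> > 0\<close> by simp
  have d_lt: "e * \<alpha> / 2 < \<alpha> / 2" using e \<open>\<alpha> > 0\<close> by simp
  have p1: "(1 + d) * (\<alpha> + 1) = \<alpha> + 1 + e * \<alpha> / 2" "(1 - d) * (\<alpha> + 1) = \<alpha> + 1 - e * \<alpha> / 2"
    using d(2) by (simp_all add: algebra_simps)
  show "\<forall>\<^sub>F s in at_top. - ln (task_tail M T s) \<le> (1 + e) * (\<alpha> * ln s)"
  proof -
    have "\<forall>\<^sub>F t in at_top. t powr (- (\<alpha> + 1 + e * \<alpha> / 2)) \<le> f t"
      using bounds[OF d(1)] f_pos eventually_gt_at_top[of 0]
    proof eventually_elim
      case (elim t)
      then have "- (\<alpha> + 1 + e * \<alpha> / 2) * ln t \<le> ln (f t)"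
        unfolding mult.assoc[symmetric] p1 by linarith
      then show ?case
        using elim by (simp add: powr_def ln_ge_iff)
    qed
    then obtain a where a: "\<And>t. t \<ge> a \<Longrightarrow> t powr (- (\<alpha> + 1 + e * \<alpha> / 2)) \<le> f t"
      by (auto simp: eventually_at_top_linorder)
    have "\<forall>\<^sub>F s in at_top. (\<alpha> + 1 + e * \<alpha> / 2) * ln 2 \<le> e * \<alpha> / 2 * ln s"
      using e \<open>\<alpha> > 0\<close> by real_asymp
    then show ?thesis
      using eventually_ge_at_top[of "max a 1"]
    proof eventually_elim
      case (elim s)
      have "(2 * s) powr (- (\<alpha> + 1 + e * \<alpha> / 2)) \<le> f t" if "s \<le> t" "t \<le> 2 * s" for t
      proof -
        have "(2 * s) powr (- (\<alpha> + 1 + e * \<alpha> / 2)) \<le> t powr (- (\<alpha> + 1 + e * \<alpha> / 2))"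
          using that elim e\<alpha> \<open>\<alpha> > 0\<close> by (intro powr_mono2') linarith+
        also have "\<dots> \<le> f t" using a that elim by simp
        finally show ?thesis .
      qed
      then have le: "(2 * s - s) * (2 * s) powr (- (\<alpha> + 1 + e * \<alpha> / 2)) \<le> task_tail M T s"
        using elim by (intro task_tail_ge) auto
      have "ln s - (\<alpha> + 1 + e * \<alpha> / 2) * ln (2 * s) = ln ((2 * s - s) * (2 * s) powr (- (\<alpha> + 1 + e * \<alpha> / 2)))"
        using elim by (simp add: ln_mult ln_powr algebra_simps)
      also have "\<dots> \<le> ln (task_tail M T s)"
        using le pos[of s] elim by (subst ln_le_cancel_iff) auto
      finally have "- ln (task_tail M T s) \<le> (\<alpha> + 1 + e * \<alpha> / 2) * (ln 2 + ln s) - ln s"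
        using elim by (simp add: ln_mult)
      also have "\<dots> = (\<alpha> + 1 + e * \<alpha> / 2) * ln 2 + (\<alpha> + e * \<alpha> / 2) * ln s"
        by (simp add: algebra_simps)
      also have "\<dots> \<le> e * \<alpha> / 2 * ln s + (\<alpha> + e * \<alpha> / 2) * ln s"
        using elim by simp
      also have "\<dots> = (1 + e) * (\<alpha> * ln s)"
        by (simp add: algebra_simps)
      finally show ?case .
    qed
  qed
  show "\<forall>\<^sub>F s in at_top. - ln (task_tail M T s) \<ge> (1 - e) * (\<alpha> * ln s)"
  proof -
    let ?\<delta> = "\<alpha> - e * \<alpha> / 2"
    have \<delta>: "?\<delta> > 0" using d_lt \<open>\<alpha> > 0\<close> by linarith
    have "\<forall>\<^sub>F t in at_top. f t \<le> 1 * t powr (- (1 + ?\<delta>))"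
      using bounds[OF d(1)] f_pos eventually_gt_at_top[of 0]
    proof eventually_elim
      case (elim t)
      then have "ln (f t) \<le> - (1 + ?\<delta>) * ln t"
        unfolding mult.assoc[symmetric] p1 by (simp add: algebra_simps)
      then have "exp (ln (f t)) \<le> exp (- (1 + ?\<delta>) * ln t)" by (subst exp_le_cancel_iff)
      then show ?case
        using elim by (simp add: powr_def)
    qed
    then obtain a where a: "\<And>t. t \<ge> a \<Longrightarrow> f t \<le> 1 * t powr (- (1 + ?\<delta>))"
      by (auto simp: eventually_at_top_linorder)
    have "\<forall>\<^sub>F s in at_top. - ln ?\<delta> \<le> e * \<alpha> / 2 * ln s"
      using e \<open>\<alpha> > 0\<close> by real_asymp
    then show ?thesis
      using eventually_ge_at_top[of "max a 1"]
    proof eventually_elim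
      case (elim s)
      have "task_tail M T s \<le> 1 * s powr (- ?\<delta>) / ?\<delta>"
        using elim a \<delta> by (intro task_tail_le_powr) auto
      then have "ln (task_tail M T s) \<le> ln (s powr (- ?\<delta>) / ?\<delta>)"
        using pos[of s] elim \<delta> by (subst ln_le_cancel_iff) auto
      also have "\<dots> = - ?\<delta> * ln s - ln ?\<delta>"
        using elim \<delta> by (simp add: ln_div ln_powr)
      finally have "?\<delta> * ln s + ln ?\<delta> \<le> - ln (task_tail M T s)"
        by (simp add: algebra_simps)
      moreover have "(1 - e) * (\<alpha> * ln s) = ?\<delta> * ln s - e * \<alpha> / 2 * ln s"
        by (simp add: algebra_simps)
      ultimately show ?case using elim by linarith
    qed
  qed
qed

end

section \<open>Asymptotics from two-sided bounds\<close>

lemma ln_ratio_tendsto_imp_tendsto_0: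
  fixes H V :: "real \<Rightarrow> real"
  assumes "((\<lambda>x. - ln (H x) / V x) \<longlongrightarrow> 1) at_top" "filterlim V at_top at_top"
    and H: "\<forall>\<^sub>F x in at_top. H x > 0"
  shows "(H \<longlongrightarrow> 0) at_top"
proof -
  have "filterlim (\<lambda>x. - ln (H x) / V x * V x) at_top at_top"
    using assms by (intro filterlim_tendsto_pos_mult_at_top) auto
  then have "((\<lambda>x. exp (- (- ln (H x) / V x * V x))) \<longlongrightarrow> 0) at_top"
    by (intro filterlim_compose[OF exp_at_bot] filterlim_compose[OF filterlim_uminus_at_bot_at_top])
  moreover have "\<forall>\<^sub>F x in at_top. exp (- (- ln (H x) / V x * V x)) = H x"
    using H filterlim_at_top_dense[THEN iffD1, OF assms(2), rule_format, of 0]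
    by eventually_elim simp
  ultimately show ?thesis by (rule Lim_transform_eventually)
qed

text \<open>The asymptotic argument rests on the two inequalities and the positivity of the tails alone, not on
  the probabilistic model behind them.\<close>

locale two_sided_tail_bounds =
  fixes A B H :: "real \<Rightarrow> real" and K t\<^sub>0 c :: real
  assumes A_pos: "\<And>s. A s > 0" and B_pos: "\<And>s. B s > 0"
    and K_pos: "K > 0" and c_pos: "c > 0"
    and lower: "\<And>x s. x \<ge> 1 \<Longrightarrow> s \<ge> t\<^sub>0 \<Longrightarrow> H x \<ge> 1 / 2 * A s * exp (- K * x * B s)"
    and upper: "\<And>x s. 0 < s \<Longrightarrow> s \<le> x / 2 \<Longrightarrow> H x \<le> A s + 2 * exp (- c * x * B s)"
begin

lemma H_pos:
  assumes "x \<ge> 1"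
  shows "H x > 0"
proof -
  have "0 < 1 / 2 * A t\<^sub>0 * exp (- K * x * B t\<^sub>0)" using A_pos by simp
  also have "\<dots> \<le> H x" using assms by (intro lower) auto
  finally show ?thesis .
qed

lemma eventually_H_pos: "\<forall>\<^sub>F x in at_top. H x > 0"
  using eventually_ge_at_top[of 1] by eventually_elim (rule H_pos)

lemma minus_ln_H_le:
  assumes "x \<ge> 1" "s \<ge> t\<^sub>0"
  shows "- ln (H x) \<le> ln 2 - ln (A s) + K * (x * B s)"
proof -
  have "ln (1 / 2 * A s * exp (- K * x * B s)) \<le> ln (H x)"
    using lower[OF assms] A_pos H_pos[OF assms(1)] by (subst ln_le_cancel_iff) auto
  moreover have "ln (1 / 2 * A s * exp (- K * x * B s)) = - ln 2 + ln (A s) - K * (x * B s)"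
    using A_pos[of s] by (simp add: ln_mult ln_div)
  ultimately show ?thesis by linarith
qed

text \<open>A sum is at most twice its larger term, so each of the two terms of the upper bound may be treated
  separately; the constants \<open>ln 2\<close> and \<open>ln 4\<close> make each term at most \<open>exp (- v) / 2\<close>.\<close>

lemma minus_ln_H_ge:
  assumes "x \<ge> 1" "0 < s" "s \<le> x / 2" "v + ln 2 \<le> - ln (A s)" "v + ln 4 \<le> c * (x * B s)"
  shows "v \<le> - ln (H x)"
proof -
  have "A s = exp (ln (A s))" using A_pos by simp
  also have "\<dots> \<le> exp (- v - ln 2)" using assms by simp
  also have "\<dots> = exp (- v) / 2" by (simp add: exp_diff)
  finally have 1: "A s \<le> exp (- v) / 2" .
  have "exp (- c * x * B s) \<le> exp (- v - ln 4)" using assms by simp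
  also have "\<dots> = exp (- v) / 4" by (simp add: exp_diff)
  finally have "H x \<le> exp (- v)"
    using upper[OF assms(2,3)] 1 by linarith
  then have "ln (H x) \<le> ln (exp (- v))"
    using H_pos[OF assms(1)] by (subst ln_le_cancel_iff) auto
  then show ?thesis by simp
qed

lemma eventually_B_less:
  assumes "((\<lambda>x. - ln (B (s x)) / ln x) \<longlongrightarrow> b) at_top" "p > 1 - b"
  shows "\<forall>\<^sub>F x in at_top. x * B (s x) \<le> x powr p"
proof -
  have "\<forall>\<^sub>F x in at_top. 1 - p < - ln (B (s x)) / ln x"
    using assms by (intro order_tendstoD) auto
  then show ?thesis
    using eventually_gt_at_top[of 1]
  proof eventually_elim
    case (elim x)
    then have "ln x + ln (B (s x)) \<le> p * ln x"
      by (simp add: field_simps)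
    then have "exp (ln (x * B (s x))) \<le> exp (p * ln x)"
      using elim B_pos[of "s x"] by (subst exp_le_cancel_iff) (simp add: ln_mult)
    then show ?case
      using elim B_pos[of "s x"] by (simp add: powr_def)
  qed
qed

lemma eventually_B_greater:
  assumes "((\<lambda>x. - ln (B (s x)) / ln x) \<longlongrightarrow> b) at_top" "p < 1 - b"
  shows "\<forall>\<^sub>F x in at_top. x powr p \<le> x * B (s x)"
proof -
  have "\<forall>\<^sub>F x in at_top. - ln (B (s x)) / ln x < 1 - p"
    using assms by (intro order_tendstoD) auto
  then show ?thesis
    using eventually_gt_at_top[of 1]
  proof eventually_elim
    case (elim x)
    then have "p * ln x \<le> ln x + ln (B (s x))"
      by (simp add: field_simps)
    then have "exp (p * ln x) \<le> exp (ln (x * B (s x)))"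
      using elim B_pos[of "s x"] by (subst exp_le_cancel_iff) (simp add: ln_mult)
    then show ?case
      using elim B_pos[of "s x"] by (simp add: powr_def)
  qed
qed

text \<open>The level \<open>s r x\<close> is the one at which \<open>B\<close> is roughly \<open>x powr (- r)\<close>. For \<open>r > 1\<close> the product
  \<open>x * B (s r x)\<close> stays bounded and the lower bound loses a constant only. For \<open>r < 1\<close> it exceeds a
  positive power of \<open>x\<close>, which dominates \<open>V\<close>. Both sides give \<open>\<kappa> r * V x\<close> to first order, and \<open>r\<close> tends
  to \<open>1\<close> at the end.\<close>

lemma log_asymptotics:
  fixes V \<kappa> :: "real \<Rightarrow> real" and s :: "real \<Rightarrow> real \<Rightarrow> real"
  assumes V: "filterlim V at_top at_top"
    and subpolynomial: "\<And>\<delta>. \<delta> > 0 \<Longrightarrow> ((\<lambda>x. V x / x powr \<delta>) \<longlongrightarrow> 0) at_top"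
    and s_top: "\<And>r. r > 0 \<Longrightarrow> filterlim (s r) at_top at_top"
    and s_le: "\<And>r. 0 < r \<Longrightarrow> r < 1 \<Longrightarrow> \<forall>\<^sub>F x in at_top. s r x \<le> x / 2"
    and B_s: "\<And>r. r > 0 \<Longrightarrow> ((\<lambda>x. - ln (B (s r x)) / ln x) \<longlongrightarrow> r) at_top"
    and A_s: "\<And>r. r > 0 \<Longrightarrow> ((\<lambda>x. - ln (A (s r x)) / V x) \<longlongrightarrow> \<kappa> r) at_top"
    and \<kappa>: "(\<kappa> \<longlongrightarrow> 1) (at 1)"
  shows "((\<lambda>x. - ln (H x) / V x) \<longlongrightarrow> 1) at_top"
proof (rule order_tendstoI)
  have V_pos: "\<forall>\<^sub>F x in at_top. V x > 0"
    using filterlim_at_top_dense[THEN iffD1, OF V] by blast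
  have const_V: "((\<lambda>x. k / V x) \<longlongrightarrow> 0) at_top" for k
    by (rule tendsto_divide_0[OF tendsto_const filterlim_at_top_imp_at_infinity[OF V]])
  {
    fix y :: real assume "y < 1"
    have "(\<kappa> \<longlongrightarrow> 1) (at_left 1)"
      using \<kappa> by (rule filterlim_mono) (auto simp: at_le)
    then have "\<forall>\<^sub>F r in at_left 1. y < \<kappa> r"
      using \<open>y < 1\<close> by (rule order_tendstoD)
    then have "\<forall>\<^sub>F r in at_left 1. y < \<kappa> r \<and> 0 < r \<and> r < 1"
      using eventually_at_left_real[OF zero_less_one] by eventually_elim auto
    then obtain r where r: "y < \<kappa> r" "0 < r" "r < 1"
      using eventually_happens'[OF trivial_limit_at_left_real] by blast
    define \<delta> where "\<delta> = (1 - r) / 2"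
    have \<delta>: "0 < \<delta>" "\<delta> < 1 - r" using r by (auto simp: \<delta>_def)
    have "((\<lambda>x. - ln (A (s r x)) / V x - ln 2 / V x) \<longlongrightarrow> \<kappa> r - 0) at_top"
      using r by (intro tendsto_diff A_s const_V)
    then have "\<forall>\<^sub>F x in at_top. - ln (A (s r x)) / V x - ln 2 / V x > (y + \<kappa> r) / 2"
      using r by (intro order_tendstoD) auto
    moreover have "((\<lambda>x. (y + \<kappa> r) / 2 * (V x / x powr \<delta>) + ln 4 / x powr \<delta>) \<longlongrightarrow> (y + \<kappa> r) / 2 * 0 + 0) at_top"
    proof (intro tendsto_add tendsto_mult tendsto_const subpolynomial \<delta>)
      show "((\<lambda>x. ln 4 / x powr \<delta>) \<longlongrightarrow> 0) at_top" using \<delta> by real_asymp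
    qed
    then have "\<forall>\<^sub>F x in at_top. (y + \<kappa> r) / 2 * (V x / x powr \<delta>) + ln 4 / x powr \<delta> < c"
      using c_pos by (intro order_tendstoD) auto
    moreover have "\<forall>\<^sub>F x in at_top. x powr \<delta> \<le> x * B (s r x)"
      using r \<delta> by (intro eventually_B_greater[OF B_s]) auto
    moreover have "\<forall>\<^sub>F x in at_top. s r x > 0"
      using filterlim_at_top_dense[THEN iffD1, OF s_top[OF r(2)]] by blast
    ultimately show "\<forall>\<^sub>F x in at_top. y < - ln (H x) / V x"
      using s_le[OF r(2,3)] V_pos eventually_ge_at_top[of 1]
    proof eventually_elim
      case (elim x)
      have "(y + \<kappa> r) / 2 * V x + ln 2 \<le> - ln (A (s r x))"
        using elim(1,6) by (simp add: field_simps)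
      moreover have "(y + \<kappa> r) / 2 * V x + ln 4 \<le> c * (x * B (s r x))"
      proof -
        have "(y + \<kappa> r) / 2 * V x + ln 4 \<le> c * x powr \<delta>"
          using elim(2,7) by (simp add: field_simps)
        also have "\<dots> \<le> c * (x * B (s r x))"
          using elim(3) c_pos by (intro mult_left_mono) auto
        finally show ?thesis .
      qed
      ultimately have "(y + \<kappa> r) / 2 * V x \<le> - ln (H x)"
        using elim by (intro minus_ln_H_ge[of x "s r x"]) auto
      moreover have "y * V x < (y + \<kappa> r) / 2 * V x"
        using r(1) elim(6) by (intro mult_strict_right_mono) auto
      ultimately have "y * V x < - ln (H x)" by linarith
      then show ?case
        using elim(6) by (subst pos_less_divide_eq)
    qed
  next
    fix y :: real assume "y > 1"
    have "(\<kappa> \<longlongrightarrow> 1) (at_right 1)"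
      using \<kappa> by (rule filterlim_mono) (auto simp: at_le)
    then have "\<forall>\<^sub>F r in at_right 1. \<kappa> r < y"
      using \<open>y > 1\<close> by (rule order_tendstoD)
    then have "\<forall>\<^sub>F r in at_right 1. \<kappa> r < y \<and> 1 < r"
      using eventually_at_right_less[of 1] by eventually_elim auto
    then obtain r where r: "\<kappa> r < y" "1 < r"
      using eventually_happens'[OF trivial_limit_at_right_real] by blast
    have "((\<lambda>x. (ln 2 + K) / V x + - ln (A (s r x)) / V x) \<longlongrightarrow> 0 + \<kappa> r) at_top"
      using r by (intro tendsto_add A_s const_V) auto
    then have "\<forall>\<^sub>F x in at_top. (ln 2 + K) / V x + - ln (A (s r x)) / V x < y"
      using r by (intro order_tendstoD) auto
    moreover have "\<forall>\<^sub>F x in at_top. x * B (s r x) \<le> x powr 0"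
      using r by (intro eventually_B_less[OF B_s]) auto
    moreover have "\<forall>\<^sub>F x in at_top. s r x \<ge> t\<^sub>0"
      using filterlim_at_top[THEN iffD1, OF s_top[of r]] r by auto
    ultimately show "\<forall>\<^sub>F x in at_top. - ln (H x) / V x < y"
      using V_pos eventually_ge_at_top[of 1]
    proof eventually_elim
      case (elim x)
      have "- ln (H x) \<le> ln 2 - ln (A (s r x)) + K * (x * B (s r x))"
        using elim by (intro minus_ln_H_le) auto
      also have "K * (x * B (s r x)) \<le> K * 1"
        using elim K_pos by (intro mult_left_mono) auto
      finally have "- ln (H x) / V x \<le> (ln 2 - ln (A (s r x)) + K * 1) / V x"
        using elim(4) by (intro divide_right_mono) auto
      also have "\<dots> = (ln 2 + K) / V x + - ln (A (s r x)) / V x"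
        by (simp add: add_divide_distrib diff_divide_distrib)
      also have "\<dots> < y" by (rule elim(1))
      finally show ?case .
    qed
  }
qed

text \<open>At the level \<open>s x\<close> both \<open>- ln (A (s x))\<close> and \<open>x * B (s x)\<close> are \<open>x powr \<theta>\<close> up to an error of
  \<open>o(1)\<close> in the exponent. That error is unavoidable, because \<open>B\<close> is known on the logarithmic scale only,
  and it is why the conclusion is weaker than in the preceding lemma.\<close>

lemma loglog_asymptotics:
  fixes s :: "real \<Rightarrow> real" and a \<theta> :: real
  assumes "\<theta> > 0" "a > 0"
    and s_top: "filterlim s at_top at_top"
    and s_le: "\<forall>\<^sub>F x in at_top. s x \<le> x / 2"
    and B_s: "((\<lambda>x. - ln (B (s x)) / ln x) \<longlongrightarrow> 1 - \<theta>) at_top"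
    and A_s: "((\<lambda>x. - ln (A (s x)) / x powr \<theta>) \<longlongrightarrow> a) at_top"
  shows "((\<lambda>x. ln (- ln (H x)) / (\<theta> * ln x)) \<longlongrightarrow> 1) at_top" "(H \<longlongrightarrow> 0) at_top"
proof -
  have s_pos: "\<forall>\<^sub>F x in at_top. s x > 0"
    using filterlim_at_top_dense[THEN iffD1, OF s_top] by blast
  have s_ge: "\<forall>\<^sub>F x in at_top. s x \<ge> t\<^sub>0"
    using filterlim_at_top[THEN iffD1, OF s_top] by blast
  have ge: "\<forall>\<^sub>F x in at_top. x powr ((1 - e) * \<theta>) \<le> - ln (H x)" if e: "0 < e" "e < 1" for e
  proof -
    have exponents: "(1 - e) * \<theta> < (1 - e / 2) * \<theta>" "(1 - e) * \<theta> < \<theta>" "(1 - e / 2) * \<theta> < \<theta>" "0 < (1 - e) * \<theta>"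
      using e \<open>\<theta> > 0\<close> by auto
    have "\<forall>\<^sub>F x in at_top. x powr ((1 - e) * \<theta>) + ln 2 \<le> a / 2 * x powr \<theta>"
      using exponents \<open>a > 0\<close> \<open>\<theta> > 0\<close> by real_asymp
    moreover have "\<forall>\<^sub>F x in at_top. x powr ((1 - e) * \<theta>) + ln 4 \<le> c * x powr ((1 - e / 2) * \<theta>)"
      using exponents c_pos by real_asymp
    moreover have "\<forall>\<^sub>F x in at_top. - ln (A (s x)) / x powr \<theta> > a / 2"
      using A_s \<open>a > 0\<close> by (intro order_tendstoD) auto
    moreover have "\<forall>\<^sub>F x in at_top. x powr ((1 - e / 2) * \<theta>) \<le> x * B (s x)"
      using exponents by (intro eventually_B_greater[OF B_s]) auto
    ultimately show ?thesis
      using s_pos s_le eventually_ge_at_top[of 1]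
    proof eventually_elim
      case (elim x)
      show ?case
      proof (rule minus_ln_H_ge[of x "s x"])
        have "a / 2 * x powr \<theta> \<le> - ln (A (s x))"
          using elim(3,7) by (simp add: field_simps)
        then show "x powr ((1 - e) * \<theta>) + ln 2 \<le> - ln (A (s x))"
          using elim(1) by linarith
        have "c * x powr ((1 - e / 2) * \<theta>) \<le> c * (x * B (s x))"
          using elim(4) c_pos by (intro mult_left_mono) auto
        then show "x powr ((1 - e) * \<theta>) + ln 4 \<le> c * (x * B (s x))"
          using elim(2) by linarith
      qed (use elim in auto)
    qed
  qed
  have le: "\<forall>\<^sub>F x in at_top. - ln (H x) \<le> x powr ((1 + e) * \<theta>)" if e: "0 < e" "e < 1" for e
  proof -
    have exponents: "(1 + e / 2) * \<theta> < (1 + e) * \<theta>" "\<theta> < (1 + e) * \<theta>" "\<theta> < (1 + e / 2) * \<theta>"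
      using e \<open>\<theta> > 0\<close> by (auto simp: algebra_simps)
    have "\<forall>\<^sub>F x in at_top. ln 2 + 2 * a * x powr \<theta> + K * x powr ((1 + e / 2) * \<theta>) \<le> x powr ((1 + e) * \<theta>)"
      using exponents \<open>a > 0\<close> \<open>\<theta> > 0\<close> K_pos by real_asymp
    moreover have "\<forall>\<^sub>F x in at_top. - ln (A (s x)) / x powr \<theta> < 2 * a"
      using A_s \<open>a > 0\<close> by (intro order_tendstoD) auto
    moreover have "\<forall>\<^sub>F x in at_top. x * B (s x) \<le> x powr ((1 + e / 2) * \<theta>)"
      using exponents by (intro eventually_B_less[OF B_s]) auto
    ultimately show ?thesis
      using s_ge eventually_ge_at_top[of 1]
    proof eventually_elim
      case (elim x)
      have "- ln (H x) \<le> ln 2 - ln (A (s x)) + K * (x * B (s x))"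
        using elim by (intro minus_ln_H_le) auto
      moreover have "K * (x * B (s x)) \<le> K * x powr ((1 + e / 2) * \<theta>)"
        using elim(3) K_pos by (intro mult_left_mono) auto
      moreover have "- ln (A (s x)) \<le> 2 * a * x powr \<theta>"
        using elim(2,5) by (simp add: field_simps)
      ultimately show ?case using elim(1) by linarith
    qed
  qed
  show "((\<lambda>x. ln (- ln (H x)) / (\<theta> * ln x)) \<longlongrightarrow> 1) at_top"
  proof (rule ratio_tendsto_1I)
    show "\<forall>\<^sub>F x in at_top. 0 < \<theta> * ln x"
      using eventually_gt_at_top[of 1] by eventually_elim (use \<open>\<theta> > 0\<close> in simp)
    fix e :: real assume e: "0 < e" "e < 1"
    show "\<forall>\<^sub>F x in at_top. ln (- ln (H x)) \<le> (1 + e) * (\<theta> * ln x)"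
      using ge[OF e] le[OF e] eventually_gt_at_top[of 1]
    proof eventually_elim
      case (elim x)
      then have "0 < x powr ((1 - e) * \<theta>)" by simp
      with elim have "0 < - ln (H x)" by linarith
      with elim have "ln (- ln (H x)) \<le> ln (x powr ((1 + e) * \<theta>))"
        by (subst ln_le_cancel_iff) auto
      then show ?case using elim by (simp add: ln_powr mult.assoc)
    qed
    show "\<forall>\<^sub>F x in at_top. (1 - e) * (\<theta> * ln x) \<le> ln (- ln (H x))"
      using ge[OF e] eventually_gt_at_top[of 1]
    proof eventually_elim
      case (elim x)
      then have "0 < x powr ((1 - e) * \<theta>)" by simp
      with elim have "0 < - ln (H x)" by linarith
      with elim have "ln (x powr ((1 - e) * \<theta>)) \<le> ln (- ln (H x))"
        by (subst ln_le_cancel_iff) auto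
      then show ?case using elim by (simp add: ln_powr mult.assoc)
    qed
  qed
  show "(H \<longlongrightarrow> 0) at_top"
  proof (rule real_tendsto_sandwich)
    show "\<forall>\<^sub>F x in at_top. 0 \<le> H x"
      using eventually_H_pos by eventually_elim simp
    show "\<forall>\<^sub>F x in at_top. H x \<le> exp (- (x powr ((1 - 1 / 2) * \<theta>)))"
      using ge[of "1 / 2", simplified] eventually_H_pos
    proof eventually_elim
      case (elim x)
      then have "exp (ln (H x)) \<le> exp (- (x powr ((1 - 1 / 2) * \<theta>)))"
        by (subst exp_le_cancel_iff) simp
      then show ?case using elim by simp
    qed
    show "((\<lambda>x. exp (- (x powr ((1 - 1 / 2) * \<theta>)))) \<longlongrightarrow> 0) at_top"
      using \<open>\<theta> > 0\<close> by real_asymp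
  qed simp
qed

end

section \<open>The tail of the total time\<close>

lemma ratio_tendsto_compose:
  fixes p w v s :: "real \<Rightarrow> real"
  assumes pw: "((\<lambda>t. p t / w t) \<longlongrightarrow> 1) at_top" and w: "\<forall>\<^sub>F t in at_top. w t > 0"
    and s: "filterlim s at_top at_top" and wv: "((\<lambda>x. w (s x) / v x) \<longlongrightarrow> k) at_top"
  shows "((\<lambda>x. p (s x) / v x) \<longlongrightarrow> k) at_top"
proof -
  have "((\<lambda>x. p (s x) / w (s x) * (w (s x) / v x)) \<longlongrightarrow> 1 * k) at_top"
    by (intro tendsto_mult filterlim_compose[OF pw s] wv)
  moreover have "\<forall>\<^sub>F x in at_top. p (s x) / w (s x) * (w (s x) / v x) = p (s x) / v x"
    using eventually_compose_filterlim[OF w s] by eventually_elim simp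
  ultimately show ?thesis by (simp add: Lim_transform_eventually)
qed

lemma log_equiv_iff_exp:
  fixes p w :: "real \<Rightarrow> real"
  shows "p \<approx>\<^sub>l\<^sub>o\<^sub>g (\<lambda>t. exp (- w t)) \<longleftrightarrow> tends_to_zero_positively p \<and>
    tends_to_zero_positively (\<lambda>t. exp (- w t)) \<and> ((\<lambda>t. - ln (p t) / w t) \<longlongrightarrow> 1) at_top"
  by (simp add: log_equiv_def)

lemma log_equiv_cong:
  assumes "\<forall>\<^sub>F t in at_top. q t = q' t"
  shows "p \<approx>\<^sub>l\<^sub>o\<^sub>g q \<longleftrightarrow> p \<approx>\<^sub>l\<^sub>o\<^sub>g q'"
proof -
  have "tends_to_zero_positively q \<longleftrightarrow> tends_to_zero_positively q'"
    unfolding tends_to_zero_positively_def using assms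
    by (intro conj_cong eventually_subst filterlim_cong refl)
       (auto elim!: eventually_mono)
  moreover have "((\<lambda>t. ln (p t) / ln (q t)) \<longlongrightarrow> 1) at_top \<longleftrightarrow> ((\<lambda>t. ln (p t) / ln (q' t)) \<longlongrightarrow> 1) at_top"
    using assms by (intro filterlim_cong refl) (auto elim!: eventually_mono)
  ultimately show ?thesis by (simp add: log_equiv_def)
qed

lemma log_equiv_powr_iff:
  "p \<approx>\<^sub>l\<^sub>o\<^sub>g (\<lambda>t. t powr (- a)) \<longleftrightarrow> p \<approx>\<^sub>l\<^sub>o\<^sub>g (\<lambda>t. exp (- (a * ln t)))"
  by (intro log_equiv_cong eventually_mono[OF eventually_gt_at_top[of 0]]) (simp add: powr_def)

context restart_model
begin

lemma failure_tail_pos: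
  assumes "\<forall>\<^sub>F t in at_top. failure_tail M U t > 0"
  shows "failure_tail M U s > 0"
proof -
  obtain a where "\<And>t. t \<ge> a \<Longrightarrow> failure_tail M U t > 0"
    using assms by (auto simp: eventually_at_top_linorder)
  then have "0 < failure_tail M U (max a s)" by simp
  also have "\<dots> \<le> failure_tail M U s" by (rule failure_tail_antimono) simp
  finally show ?thesis .
qed

text \<open>A tail heavier than \<open>1 / t\<close> on the logarithmic scale would contradict Markov's inequality.\<close>

lemma failure_exponent_ge_1:
  assumes "((\<lambda>t. - ln (failure_tail M U t) / (\<beta> * ln t)) \<longlongrightarrow> 1) at_top" "\<beta> > 0"
    and pos: "\<And>t. failure_tail M U t > 0"
  shows "\<beta> \<ge> 1"
proof -
  define m where "m = expectation (U 0)"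
  have "m > 0" unfolding m_def by (rule expectation_U_pos[OF pos])
  have "1 / \<beta> \<le> 1"
  proof (rule tendsto_le[OF _ assms(1)])
    have "((\<lambda>t. (ln t - ln m) / (\<beta> * ln t)) \<longlongrightarrow> inverse \<beta>) at_top"
      using \<open>\<beta> > 0\<close> by real_asymp
    then show "((\<lambda>t. (ln t - ln m) / (\<beta> * ln t)) \<longlongrightarrow> 1 / \<beta>) at_top"
      by (simp add: inverse_eq_divide)
    show "\<forall>\<^sub>F t in at_top. (ln t - ln m) / (\<beta> * ln t) \<le> - ln (failure_tail M U t) / (\<beta> * ln t)"
      using eventually_gt_at_top[of 1]
    proof eventually_elim
      case (elim t)
      then have "ln (t * failure_tail M U t) \<le> ln m"
        using failure_tail_Markov[of t] pos[of t] \<open>m > 0\<close>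
        by (subst ln_le_cancel_iff) (auto simp: m_def)
      then have "ln t - ln m \<le> - ln (failure_tail M U t)"
        using elim pos[of t] by (simp add: ln_mult)
      then show ?case
        using elim \<open>\<beta> > 0\<close> by (intro divide_right_mono) auto
    qed
  qed simp
  then show ?thesis using \<open>\<beta> > 0\<close> by (simp add: field_simps)
qed

lemma tail_bounds:
  assumes f: "\<forall>\<^sub>F t in at_top. f t > 0" and U: "\<forall>\<^sub>F t in at_top. failure_tail M U t > 0"
  obtains K t\<^sub>0 c where
    "two_sided_tail_bounds (task_tail M T) (failure_tail M U) (total_time_tail M T U) K t\<^sub>0 c"
proof -
  note pos = failure_tail_pos[OF U]
  obtain K t\<^sub>0 where K: "K > 0"
    "\<And>x s. x \<ge> 1 \<Longrightarrow> s \<ge> t\<^sub>0 \<Longrightarrow>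
       total_time_tail M T U x \<ge> 1 / 2 * task_tail M T s * exp (- K * x * failure_tail M U s)"
    using total_time_tail_lower_bound[OF pos] by metis
  have "two_sided_tail_bounds (task_tail M T) (failure_tail M U) (total_time_tail M T U) K t\<^sub>0
     (1 / (8 * expectation (U 0)))"
    using K total_time_tail_upper_bound[OF pos] expectation_U_pos[OF pos]
    by unfold_locales (auto intro: task_tail_pos_of_density[OF f] pos)
  then show ?thesis by (rule that)
qed

text \<open>The form of the logarithmic result used below: \<open>v\<close> and \<open>w\<close> are explicit exponents of the two
  tails, so that only explicit functions have to be evaluated along the level \<open>s r x\<close>.\<close>

lemma total_time_tail_log_equiv:
  fixes V \<kappa> w v :: "real \<Rightarrow> real" and s :: "real \<Rightarrow> real \<Rightarrow> real"
  assumes f: "\<forall>\<^sub>F t in at_top. f t > 0" and U: "\<forall>\<^sub>F t in at_top. failure_tail M U t > 0"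
    and v: "((\<lambda>t. - ln (task_tail M T t) / v t) \<longlongrightarrow> 1) at_top" "\<forall>\<^sub>F t in at_top. v t > 0"
    and w: "((\<lambda>t. - ln (failure_tail M U t) / w t) \<longlongrightarrow> 1) at_top" "\<forall>\<^sub>F t in at_top. w t > 0"
    and V: "filterlim V at_top at_top"
    and subpolynomial: "\<And>\<delta>. \<delta> > 0 \<Longrightarrow> ((\<lambda>x. V x / x powr \<delta>) \<longlongrightarrow> 0) at_top"
    and s_top: "\<And>r. r > 0 \<Longrightarrow> filterlim (s r) at_top at_top"
    and s_le: "\<And>r. 0 < r \<Longrightarrow> r < 1 \<Longrightarrow> \<forall>\<^sub>F x in at_top. s r x \<le> x / 2"
    and w_s: "\<And>r. r > 0 \<Longrightarrow> ((\<lambda>x. w (s r x) / ln x) \<longlongrightarrow> r) at_top"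
    and v_s: "\<And>r. r > 0 \<Longrightarrow> ((\<lambda>x. v (s r x) / V x) \<longlongrightarrow> \<kappa> r) at_top"
    and \<kappa>: "(\<kappa> \<longlongrightarrow> 1) (at 1)"
  shows "total_time_tail M T U \<approx>\<^sub>l\<^sub>o\<^sub>g (\<lambda>x. exp (- V x))"
proof -
  obtain K t\<^sub>0 c where "two_sided_tail_bounds (task_tail M T) (failure_tail M U) (total_time_tail M T U) K t\<^sub>0 c"
    using tail_bounds[OF f U] .
  then interpret two_sided_tail_bounds "task_tail M T" "failure_tail M U" "total_time_tail M T U" K t\<^sub>0 c .
  have lim: "((\<lambda>x. - ln (total_time_tail M T U x) / V x) \<longlongrightarrow> 1) at_top"
    using V subpolynomial s_top s_le ratio_tendsto_compose[OF w s_top w_s]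
      ratio_tendsto_compose[OF v s_top v_s] \<kappa>
    by (rule log_asymptotics)
  moreover have "tends_to_zero_positively (total_time_tail M T U)"
    unfolding tends_to_zero_positively_def
    using eventually_H_pos ln_ratio_tendsto_imp_tendsto_0[OF lim V eventually_H_pos] by simp
  moreover have "tends_to_zero_positively (\<lambda>x. exp (- V x))"
    unfolding tends_to_zero_positively_def
    by (auto intro!: filterlim_compose[OF exp_at_bot] filterlim_compose[OF filterlim_uminus_at_bot_at_top] V)
  ultimately show ?thesis by (simp add: log_equiv_iff_exp)
qed

end

lemma eventually_powr_pos: "a > 0 \<Longrightarrow> \<forall>\<^sub>F t in at_top. a * t powr b > (0::real)"
  by (rule eventually_mono[OF eventually_gt_at_top[of 0]]) simp

lemma eventually_ln_pos: "a > 0 \<Longrightarrow> \<forall>\<^sub>F t in at_top. a * ln t > (0::real)"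
  by (rule eventually_mono[OF eventually_gt_at_top[of 1]]) simp

theorem theorem2p1:
  fixes M :: "'a measure" and T :: "'a \<Rightarrow> real" and U :: "nat \<Rightarrow> 'a \<Rightarrow> real"
    and f g :: "real \<Rightarrow> real" and \<alpha> \<eta> \<beta> \<gamma> :: real
  assumes "restart_model M T U f g"
    and "\<alpha> > 0" and "\<eta> > 0" and "\<beta> > 0" and "\<gamma> > 0"
  shows
    "(f \<approx>\<^sub>l\<^sub>o\<^sub>g (\<lambda>t. exp (- \<alpha> * t powr \<eta>)) \<and>
      failure_tail M U \<approx>\<^sub>l\<^sub>o\<^sub>g (\<lambda>t. exp (- \<beta> * t powr \<gamma>)) \<longrightarrow>
      (let \<theta> = \<eta> / \<gamma>; c = \<alpha> / \<beta> powr \<theta> in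
        total_time_tail M T U \<approx>\<^sub>l\<^sub>o\<^sub>g (\<lambda>x. exp (- c * ln x powr \<theta>)))) \<and>
     (f \<approx>\<^sub>l\<^sub>o\<^sub>g (\<lambda>t. t powr (- (\<alpha> + 1))) \<and>
      failure_tail M U \<approx>\<^sub>l\<^sub>o\<^sub>g (\<lambda>t. t powr (- \<beta>)) \<longrightarrow>
      (let \<theta> = \<alpha> / \<beta> in
        total_time_tail M T U \<approx>\<^sub>l\<^sub>o\<^sub>g (\<lambda>x. x powr (- \<theta>)))) \<and>
     (f \<approx>\<^sub>l\<^sub>o\<^sub>g (\<lambda>t. t powr (- (\<alpha> + 1))) \<and>
      failure_tail M U \<approx>\<^sub>l\<^sub>o\<^sub>g (\<lambda>t. exp (- \<beta> * t powr \<gamma>)) \<longrightarrow>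
      (let \<theta> = \<alpha> / \<gamma> in
        total_time_tail M T U \<approx>\<^sub>l\<^sub>o\<^sub>g (\<lambda>x. ln x powr (- \<theta>)))) \<and>
     (f \<approx>\<^sub>l\<^sub>o\<^sub>g (\<lambda>t. exp (- \<alpha> * t powr \<eta>)) \<and>
      failure_tail M U \<approx>\<^sub>l\<^sub>o\<^sub>g (\<lambda>t. t powr (- \<beta>)) \<longrightarrow>
      (let \<theta> = \<eta> / (\<beta> + \<eta>) in
        \<theta> \<in> {0<..<1} \<and>
        total_time_tail M T U \<approx>\<^sub>l\<^sub>o\<^sub>g\<^sub>l\<^sub>o\<^sub>g (\<lambda>x. exp (- (x powr \<theta>)))))"
    (is "(?f_exp \<and> ?G_exp \<longrightarrow> ?case11) \<and> (?f_pow \<and> ?G_pow \<longrightarrow> ?case22) \<and>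
         (?f_pow \<and> ?G_exp \<longrightarrow> ?case21) \<and> (?f_exp \<and> ?G_pow \<longrightarrow> ?case12)")
proof -
  interpret restart_model M T U f g by fact
  note params = \<open>\<alpha> > 0\<close> \<open>\<eta> > 0\<close> \<open>\<beta> > 0\<close> \<open>\<gamma> > 0\<close>
  note ev_pos = eventually_powr_pos[OF \<open>\<alpha> > 0\<close>] eventually_powr_pos[OF \<open>\<beta> > 0\<close>]
    eventually_ln_pos[OF \<open>\<alpha> > 0\<close>] eventually_ln_pos[OF \<open>\<beta> > 0\<close>]
  have f_pos: "\<forall>\<^sub>F t in at_top. f t > 0" if "f \<approx>\<^sub>l\<^sub>o\<^sub>g h" for h
    using that by (auto simp: log_equiv_def tends_to_zero_positively_def)
  have U_pos: "\<forall>\<^sub>F t in at_top. failure_tail M U t > 0" if "failure_tail M U \<approx>\<^sub>l\<^sub>o\<^sub>g h" for h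
    using that by (auto simp: log_equiv_def tends_to_zero_positively_def)
  have G_exp: "((\<lambda>t. - ln (failure_tail M U t) / (\<beta> * t powr \<gamma>)) \<longlongrightarrow> 1) at_top" if ?G_exp
    using that by (simp add: log_equiv_iff_exp)
  have G_pow: "((\<lambda>t. - ln (failure_tail M U t) / (\<beta> * ln t)) \<longlongrightarrow> 1) at_top" if ?G_pow
    using that by (simp add: log_equiv_powr_iff log_equiv_iff_exp)
  have \<beta>_ge: "\<beta> \<ge> 1" if ?G_pow
    using failure_exponent_ge_1[OF G_pow[OF that] \<open>\<beta> > 0\<close> failure_tail_pos[OF U_pos[OF that]]] .
  \<comment> \<open>\<open>s_exp r x\<close> solves \<open>\<beta> * s powr \<gamma> = r * ln x\<close>, and \<open>s_pow r x\<close> below solves \<open>\<beta> * ln s = r * ln x\<close>.\<close>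
  define s_exp where "s_exp r x = (r * ln x / \<beta>) powr (1 / \<gamma>)" for r x :: real
  have s_exp_top: "filterlim (s_exp r) at_top at_top" if "r > 0" for r
    unfolding s_exp_def[abs_def] using that params by real_asymp
  have s_exp_le: "\<forall>\<^sub>F x in at_top. s_exp r x \<le> x / 2" if "r > 0" for r
    unfolding s_exp_def using that params by real_asymp
  have w_s_exp: "((\<lambda>x. \<beta> * s_exp r x powr \<gamma> / ln x) \<longlongrightarrow> r) at_top" if "r > 0" for r
  proof -
    have "\<forall>\<^sub>F x in at_top. r = \<beta> * s_exp r x powr \<gamma> / ln x"
      using eventually_gt_at_top[of 1]
      by eventually_elim (use that params in \<open>simp add: s_exp_def powr_powr\<close>)
    with tendsto_const show ?thesis by (rule Lim_transform_eventually)
  qed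
  define s_pow where "s_pow r x = x powr (r / \<beta>)" for r x :: real
  have s_pow_top: "filterlim (s_pow r) at_top at_top" if "r > 0" for r
    unfolding s_pow_def[abs_def] using that params by real_asymp

  have ?case11 if H: ?f_exp ?G_exp
  proof -
    let ?V = "\<lambda>x. \<alpha> / \<beta> powr (\<eta> / \<gamma>) * ln x powr (\<eta> / \<gamma>)"
    have "total_time_tail M T U \<approx>\<^sub>l\<^sub>o\<^sub>g (\<lambda>x. exp (- ?V x))"
    proof (rule total_time_tail_log_equiv[where s = s_exp and \<kappa> = "\<lambda>r. r powr (\<eta> / \<gamma>)"])
      show "\<forall>\<^sub>F t in at_top. f t > 0" "\<forall>\<^sub>F t in at_top. failure_tail M U t > 0"
        using f_pos U_pos H by blast+
      show "((\<lambda>t. - ln (task_tail M T t) / (\<alpha> * t powr \<eta>)) \<longlongrightarrow> 1) at_top"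
        using H(1) params(1,2) by (rule task_tail_asymp_exp)
      show "((\<lambda>t. - ln (failure_tail M U t) / (\<beta> * t powr \<gamma>)) \<longlongrightarrow> 1) at_top"
        using H by (intro G_exp)
      show "filterlim ?V at_top at_top"
        using params by real_asymp
      show "((\<lambda>x. ?V x / x powr \<delta>) \<longlongrightarrow> 0) at_top" if "\<delta> > 0" for \<delta>
        using that params by real_asymp
      show "((\<lambda>x. \<alpha> * s_exp r x powr \<eta> / ?V x) \<longlongrightarrow> r powr (\<eta> / \<gamma>)) at_top" if "r > 0" for r
      proof -
        have "\<forall>\<^sub>F x in at_top. r powr (\<eta> / \<gamma>) = \<alpha> * s_exp r x powr \<eta> / ?V x"
          using eventually_gt_at_top[of 1]
          by eventually_elim
             (use that params in \<open>simp add: s_exp_def powr_powr powr_mult powr_divide\<close>)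
        with tendsto_const show ?thesis by (rule Lim_transform_eventually)
      qed
      show "((\<lambda>r. r powr (\<eta> / \<gamma>)) \<longlongrightarrow> 1) (at 1)"
        by (auto intro!: tendsto_eq_intros)
    qed (use s_exp_top s_exp_le w_s_exp ev_pos in auto)
    then show ?thesis by (simp add: Let_def)
  qed
  moreover have ?case22 if H: ?f_pow ?G_pow
  proof -
    let ?V = "\<lambda>x. \<alpha> / \<beta> * ln x"
    have "total_time_tail M T U \<approx>\<^sub>l\<^sub>o\<^sub>g (\<lambda>x. exp (- ?V x))"
    proof (rule total_time_tail_log_equiv[where s = s_pow and \<kappa> = "\<lambda>r. r"])
      show "\<forall>\<^sub>F t in at_top. f t > 0" "\<forall>\<^sub>F t in at_top. failure_tail M U t > 0"
        using f_pos U_pos H by blast+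
      show "((\<lambda>t. - ln (task_tail M T t) / (\<alpha> * ln t)) \<longlongrightarrow> 1) at_top"
        using H(1) params(1) by (rule task_tail_asymp_powr)
      show "((\<lambda>t. - ln (failure_tail M U t) / (\<beta> * ln t)) \<longlongrightarrow> 1) at_top"
        using H by (intro G_pow)
      show "filterlim ?V at_top at_top"
        using params by real_asymp
      show "((\<lambda>x. ?V x / x powr \<delta>) \<longlongrightarrow> 0) at_top" if "\<delta> > 0" for \<delta>
        using that params by real_asymp
      show "\<forall>\<^sub>F x in at_top. s_pow r x \<le> x / 2" if "0 < r" "r < 1" for r
      proof -
        have "r / \<beta> < 1" using that \<beta>_ge[OF H(2)] by simp
        then show ?thesis unfolding s_pow_def by real_asymp
      qed
      show "((\<lambda>x. \<beta> * ln (s_pow r x) / ln x) \<longlongrightarrow> r) at_top" if "r > 0" for r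
      proof -
        have "\<forall>\<^sub>F x in at_top. r = \<beta> * ln (s_pow r x) / ln x"
          using eventually_gt_at_top[of 1]
          by eventually_elim (use that params in \<open>simp add: s_pow_def ln_powr\<close>)
        with tendsto_const show ?thesis by (rule Lim_transform_eventually)
      qed
      show "((\<lambda>x. \<alpha> * ln (s_pow r x) / ?V x) \<longlongrightarrow> r) at_top" if "r > 0" for r
      proof -
        have "\<forall>\<^sub>F x in at_top. r = \<alpha> * ln (s_pow r x) / ?V x"
          using eventually_gt_at_top[of 1]
          by eventually_elim (use that params in \<open>simp add: s_pow_def ln_powr\<close>)
        with tendsto_const show ?thesis by (rule Lim_transform_eventually)
      qed
    qed (use s_pow_top ev_pos in auto)
    then show ?thesis by (simp add: Let_def log_equiv_powr_iff)
  qed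
  moreover have ?case21 if H: ?f_pow ?G_exp
  proof -
    let ?V = "\<lambda>x. \<alpha> / \<gamma> * ln (ln x)"
    have "total_time_tail M T U \<approx>\<^sub>l\<^sub>o\<^sub>g (\<lambda>x. exp (- ?V x))"
    proof (rule total_time_tail_log_equiv[where s = s_exp and \<kappa> = "\<lambda>r. 1"])
      show "\<forall>\<^sub>F t in at_top. f t > 0" "\<forall>\<^sub>F t in at_top. failure_tail M U t > 0"
        using f_pos U_pos H by blast+
      show "((\<lambda>t. - ln (task_tail M T t) / (\<alpha> * ln t)) \<longlongrightarrow> 1) at_top"
        using H(1) params(1) by (rule task_tail_asymp_powr)
      show "((\<lambda>t. - ln (failure_tail M U t) / (\<beta> * t powr \<gamma>)) \<longlongrightarrow> 1) at_top"
        using H by (intro G_exp)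
      show "filterlim ?V at_top at_top"
        using params by real_asymp
      show "((\<lambda>x. ?V x / x powr \<delta>) \<longlongrightarrow> 0) at_top" if "\<delta> > 0" for \<delta>
        using that params by real_asymp
      show "((\<lambda>x. \<alpha> * ln (s_exp r x) / ?V x) \<longlongrightarrow> 1) at_top" if "r > 0" for r
        unfolding s_exp_def using that params by real_asymp
    qed (use s_exp_top s_exp_le w_s_exp ev_pos in auto)
    moreover have "\<forall>\<^sub>F x in at_top. exp (- ?V x) = ln x powr (- (\<alpha> / \<gamma>))"
      using eventually_gt_at_top[of 1] by eventually_elim (simp add: powr_def)
    ultimately show ?thesis by (simp add: Let_def log_equiv_cong)
  qed
  moreover have ?case12 if H: ?f_exp ?G_pow
  proof -
    define \<theta> where "\<theta> = \<eta> / (\<beta> + \<eta>)"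
    have \<theta>: "0 < \<theta>" "\<theta> < 1" "1 - \<theta> = \<beta> / (\<beta> + \<eta>)"
      using params by (auto simp: \<theta>_def field_simps add_pos_pos)
    obtain K t\<^sub>0 c where "two_sided_tail_bounds (task_tail M T) (failure_tail M U) (total_time_tail M T U) K t\<^sub>0 c"
      using tail_bounds[OF f_pos[OF H(1)] U_pos[OF H(2)]] .
    then interpret two_sided_tail_bounds "task_tail M T" "failure_tail M U" "total_time_tail M T U" K t\<^sub>0 c .
    let ?s = "\<lambda>x. x powr (1 / (\<beta> + \<eta>))"
    have e: "0 < 1 / (\<beta> + \<eta>)" "1 / (\<beta> + \<eta>) < 1"
      using \<beta>_ge[OF H(2)] params by (auto simp: add_pos_pos)
    have s_top: "filterlim ?s at_top at_top"
      using e by real_asymp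
    have s_le: "\<forall>\<^sub>F x in at_top. ?s x \<le> x / 2"
      using e by real_asymp
    have "((\<lambda>x. \<beta> * ln (?s x) / ln x) \<longlongrightarrow> 1 - \<theta>) at_top"
    proof -
      have "\<forall>\<^sub>F x in at_top. 1 - \<theta> = \<beta> * ln (?s x) / ln x"
        using eventually_gt_at_top[of 1] by eventually_elim (simp add: \<theta>(3) ln_powr)
      with tendsto_const show ?thesis by (rule Lim_transform_eventually)
    qed
    from ratio_tendsto_compose[OF G_pow[OF H(2)] ev_pos(4) s_top this]
    have B_s: "((\<lambda>x. - ln (failure_tail M U (?s x)) / ln x) \<longlongrightarrow> 1 - \<theta>) at_top" .
    have "((\<lambda>x. \<alpha> * ?s x powr \<eta> / x powr \<theta>) \<longlongrightarrow> \<alpha>) at_top"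
    proof -
      have "\<forall>\<^sub>F x in at_top. \<alpha> = \<alpha> * ?s x powr \<eta> / x powr \<theta>"
        using eventually_gt_at_top[of 1] by eventually_elim (use params in \<open>simp add: \<theta>_def powr_powr\<close>)
      with tendsto_const show ?thesis by (rule Lim_transform_eventually)
    qed
    from ratio_tendsto_compose[OF task_tail_asymp_exp[OF H(1) params(1,2)] ev_pos(1) s_top this]
    have A_s: "((\<lambda>x. - ln (task_tail M T (?s x)) / x powr \<theta>) \<longlongrightarrow> \<alpha>) at_top" .
    note lims = loglog_asymptotics[OF \<theta>(1) \<open>\<alpha> > 0\<close> s_top s_le B_s A_s]
    have "((\<lambda>x. ln (- ln (total_time_tail M T U x)) / ln (- ln (exp (- (x powr \<theta>))))) \<longlongrightarrow> 1) at_top"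
      using lims(1)
    proof (rule Lim_transform_eventually)
      show "\<forall>\<^sub>F x in at_top. ln (- ln (total_time_tail M T U x)) / (\<theta> * ln x) =
          ln (- ln (total_time_tail M T U x)) / ln (- ln (exp (- (x powr \<theta>))))"
        using eventually_gt_at_top[of 0] by eventually_elim (simp add: ln_powr)
    qed
    moreover have "tends_to_zero_positively (total_time_tail M T U)"
      using eventually_H_pos lims(2) by (simp add: tends_to_zero_positively_def)
    moreover have "tends_to_zero_positively (\<lambda>x. exp (- (x powr \<theta>)))"
      unfolding tends_to_zero_positively_def using \<theta>(1) by (auto; real_asymp)
    ultimately show ?thesis
      using \<theta> by (simp add: Let_def loglog_equiv_def flip: \<theta>_def)
  qed
  ultimately show ?thesis by blast
qed

end
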